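(* Let $\alpha\in(0,1)$, $\beta\in(0,1)$ and $\rho,\mu,\lambda>0$. The generalized fractional negative binomial process $\{\mathcal{G}(t)\}_{t\ge 0}$, $\mathcal{G}(t)=N_\beta(M(t),\lambda)$, is not infinitely divisible.
   Context: Fractional Poisson process (FPP): for $0<\beta<1$, let $\{S_\beta(t)\}_{t\ge0}$ be the $\beta$-stable subordinator with $\mathbb{E}[e^{-uS_\beta(t)}]=e^{-tu^\beta}$, and let $E_\beta(t)=\inf\{r\ge 0: S_\beta(r)>t\}$ be its inverse. The FPP with parameter $\lambda>0$ is $N_\beta(t,\lambda)=N(E_\beta(t),\lambda)$, where $\{N(t,\lambda)\}_{t\ge0}$ is a homogeneous Poisson process of rate $\lambda$ independent of $E_\beta$. Mittag-Leffler (ML) Lévy subordinator: for $\alpha\in(0,1)$ and $\rho,\mu>0$, $M(t)=M_{\alpha,\rho,\mu}(t)$ is the non-decreasing Lévy process with $M(0)=0$ and $\mathbb{E}[e^{-uM(t)}]=\left(\frac{\mu}{\mu+u^\alpha}\right)^{\rho t}$, $u\ge 0$. Generalized fractional negative binomial process (GFNBP): $\mathcal{G}(t)=\mathcal{G}_{\alpha,\rho}^{\mu,\beta}(t,\lambda):=N_\beta(M_{\alpha,\rho,\mu}(t),\lambda)$, $t\ge 0$, where $M$ is independent of $N_\beta$. A stochastic process is called infinitely divisible if all of its finite-dimensional distributions are infinitely divisible. *)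

theory Defs
  imports "HOL-Probability.Probability"
begin

section \<open>Levy processes\<close>

text \<open>
  A real-valued process on a probability space \<open>P\<close> is a function \<open>X :: real \<Rightarrow> 'w \<Rightarrow> real\<close>; only its
  values \<open>X t\<close> for \<open>t \<ge> 0\<close> matter.
\<close>

definition cadlag :: "(real \<Rightarrow> real) \<Rightarrow> bool" where
  "cadlag f \<longleftrightarrow>
     (\<forall>t\<ge>0. continuous (at_right t) f) \<and> (\<forall>t>0. \<exists>l. (f \<longlongrightarrow> l) (at_left t))"

text \<open>
  Path properties are required for every sample point (the canonical version of the process), so
  that processes composed with random times are random variables. Stochastic continuity is not
  listed separately: it follows from the cadlag paths and the stationarity of the increments.
\<close>

definition levy_process :: "'w measure \<Rightarrow> (real \<Rightarrow> 'w \<Rightarrow> real) \<Rightarrow> bool" where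
  "levy_process P X \<longleftrightarrow>
     (\<forall>t\<ge>0. X t \<in> borel_measurable P) \<and>
     (\<forall>\<omega>\<in>space P. X 0 \<omega> = 0) \<and>
     (\<forall>\<omega>\<in>space P. cadlag (\<lambda>t. X t \<omega>)) \<and>
     (\<forall>(n::nat) ts. 0 \<le> ts 0 \<and> (\<forall>i<n. ts i \<le> ts (Suc i)) \<longrightarrow>
        prob_space.indep_vars P (\<lambda>_. borel) (\<lambda>i \<omega>. X (ts (Suc i)) \<omega> - X (ts i) \<omega>) {..<n}) \<and>
     (\<forall>s\<ge>0. \<forall>h\<ge>0. distr P borel (\<lambda>\<omega>. X (s + h) \<omega> - X s \<omega>) = distr P borel (X h))"

definition subordinator :: "'w measure \<Rightarrow> (real \<Rightarrow> 'w \<Rightarrow> real) \<Rightarrow> bool" where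
  "subordinator P X \<longleftrightarrow> levy_process P X \<and> (\<forall>\<omega>\<in>space P. mono_on {0..} (\<lambda>t. X t \<omega>))"

definition stable_subordinator :: "'w measure \<Rightarrow> real \<Rightarrow> (real \<Rightarrow> 'w \<Rightarrow> real) \<Rightarrow> bool" where
  "stable_subordinator P \<beta> S \<longleftrightarrow> subordinator P S \<and>
     (\<forall>t\<ge>0. \<forall>u\<ge>0. (\<integral>\<omega>. exp (- u * S t \<omega>) \<partial>P) = exp (- t * u powr \<beta>))"

definition mittag_leffler_subordinator ::
    "'w measure \<Rightarrow> real \<Rightarrow> real \<Rightarrow> real \<Rightarrow> (real \<Rightarrow> 'w \<Rightarrow> real) \<Rightarrow> bool" where
  "mittag_leffler_subordinator P \<alpha> \<rho> \<mu> M \<longleftrightarrow> subordinator P M \<and>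
     (\<forall>t\<ge>0. \<forall>u\<ge>0. (\<integral>\<omega>. exp (- u * M t \<omega>) \<partial>P) = (\<mu> / (\<mu> + u powr \<alpha>)) powr (\<rho> * t))"

definition poisson_process :: "'w measure \<Rightarrow> real \<Rightarrow> (real \<Rightarrow> 'w \<Rightarrow> nat) \<Rightarrow> bool" where
  "poisson_process P rate N \<longleftrightarrow> levy_process P (\<lambda>t \<omega>. real (N t \<omega>)) \<and>
     (\<forall>t>0. distr P (count_space UNIV) (N t) = measure_pmf (poisson_pmf (rate * t)))"

section \<open>Time-changed processes\<close>

text \<open>
  The infimum is over a nonempty set for all \<open>t\<close> exactly when the path of \<open>S\<close> is unbounded, which is
  almost surely the case for a stable subordinator. On the remaining null event we set the inverse to
  \<open>0\<close> where it would be infinite, so that it is always a legitimate (nonnegative real) time.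
\<close>

definition inverse_subordinator :: "(real \<Rightarrow> 'w \<Rightarrow> real) \<Rightarrow> real \<Rightarrow> 'w \<Rightarrow> real" where
  "inverse_subordinator S t \<omega> =
     (if \<exists>r\<ge>0. S r \<omega> > t then Inf {r. 0 \<le> r \<and> S r \<omega> > t} else 0)"

definition time_change :: "(real \<Rightarrow> 'w \<Rightarrow> 'b) \<Rightarrow> (real \<Rightarrow> 'w \<Rightarrow> real) \<Rightarrow> real \<Rightarrow> 'w \<Rightarrow> 'b" where
  "time_change X T t \<omega> = X (T t \<omega>) \<omega>"

definition fractional_poisson ::
    "(real \<Rightarrow> 'w \<Rightarrow> nat) \<Rightarrow> (real \<Rightarrow> 'w \<Rightarrow> real) \<Rightarrow> real \<Rightarrow> 'w \<Rightarrow> nat" where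
  "fractional_poisson N S = time_change N (inverse_subordinator S)"

definition gfnbp ::
    "(real \<Rightarrow> 'w \<Rightarrow> nat) \<Rightarrow> (real \<Rightarrow> 'w \<Rightarrow> real) \<Rightarrow> (real \<Rightarrow> 'w \<Rightarrow> real) \<Rightarrow> real \<Rightarrow> 'w \<Rightarrow> nat" where
  "gfnbp N S M = time_change (fractional_poisson N S) M"

text \<open>
  Independence of the whole processes, i.e. of the sigma-algebras generated by
  \<open>(X t)\<close>, \<open>t \<ge> 0\<close>, and \<open>(Y t)\<close>, \<open>t \<ge> 0\<close>.
\<close>

definition indep_processes ::
    "'w measure \<Rightarrow> (real \<Rightarrow> 'w \<Rightarrow> real) \<Rightarrow> (real \<Rightarrow> 'w \<Rightarrow> real) \<Rightarrow> bool" where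
  "indep_processes P X Y \<longleftrightarrow>
     prob_space.indep_var P
       (PiM {0..} (\<lambda>_. borel)) (\<lambda>\<omega>. \<lambda>t\<in>{0..}. X t \<omega>)
       (PiM {0..} (\<lambda>_. borel)) (\<lambda>\<omega>. \<lambda>t\<in>{0..}. Y t \<omega>)"

section \<open>Infinite divisibility\<close>

text \<open>
  A law \<open>\<nu>\<close> on the space of real vectors indexed by \<open>I\<close> is infinitely divisible if for every
  \<open>m \<ge> 1\<close> it is the law of a sum of \<open>m\<close> i.i.d. vectors, i.e. the \<open>m\<close>-fold convolution power of some
  probability law \<open>\<kappa>\<close>; below, \<open>x k\<close> is the \<open>k\<close>-th of these vectors.
\<close>

definition infinitely_divisible :: "'i set \<Rightarrow> ('i \<Rightarrow> real) measure \<Rightarrow> bool" where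
  "infinitely_divisible I \<nu> \<longleftrightarrow>
     (\<forall>m::nat. m \<ge> 1 \<longrightarrow>
        (\<exists>\<kappa>. prob_space \<kappa> \<and> sets \<kappa> = sets (PiM I (\<lambda>_. borel)) \<and>
           \<nu> = distr (PiM {..<m} (\<lambda>_. \<kappa>)) (PiM I (\<lambda>_. borel)) (\<lambda>x. \<lambda>i\<in>I. \<Sum>k<m. x k i)))"

definition finite_dim_distr ::
    "'w measure \<Rightarrow> (real \<Rightarrow> 'w \<Rightarrow> real) \<Rightarrow> real set \<Rightarrow> (real \<Rightarrow> real) measure" where
  "finite_dim_distr P X J = distr P (PiM J (\<lambda>_. borel)) (\<lambda>\<omega>. \<lambda>t\<in>J. X t \<omega>)"

definition infinitely_divisible_process :: "'w measure \<Rightarrow> (real \<Rightarrow> 'w \<Rightarrow> real) \<Rightarrow> bool" where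
  "infinitely_divisible_process P X \<longleftrightarrow>
     (\<forall>J. finite J \<and> J \<noteq> {} \<and> J \<subseteq> {0..} \<longrightarrow> infinitely_divisible J (finite_dim_distr P X J))"

end

theory Submission
  imports Defs "HOL-Real_Asymp.Real_Asymp"
begin

text \<open>
  Write \<open>G\<close> for the process, \<open>E\<close> for the inverse stable subordinator and \<open>F = N \<circ> E\<close> for the
  fractional Poisson process, so that \<open>G = F \<circ> M\<close>. One-dimensional marginals do not help: they can
  very well be infinitely divisible. For \<open>\<alpha> = \<beta>\<close> and \<open>\<rho> t = 1\<close>, for instance, the marginal is a Poisson
  mixture whose mixing law is itself a mixture of exponential laws. The obstruction is a correlation
  between two increments.

  \<^emph>\<open>Infinite divisibility forces positive correlation.\<close> Let \<open>(U, V)\<close> be nonnegative and infinitely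
  divisible. If it is the sum of \<open>m\<close> independent copies of \<open>(u, v)\<close>, then \<open>u, v \<ge> 0\<close>, a sum vanishes iff
  all its terms do, and so \<open>P(U = 0) = p\<^sup>m\<close>, \<open>P(V = 0) = q\<^sup>m\<close> and \<open>P(U = V = 0) = r\<^sup>m\<close> with \<open>p, q, r\<close>
  the corresponding probabilities for \<open>(u, v)\<close>. As \<open>r \<ge> p + q - 1\<close>, letting \<open>m\<close> grow gives
  \<open>P(U = V = 0) \<ge> P(U = 0) P(V = 0)\<close>; see \<open>infinitely_divisible_zero_sets_positively_correlated\<close>.

  \<^emph>\<open>For small \<open>s\<close> and large \<open>H\<close> the silences of \<open>G\<close> on \<open>[0, s]\<close> and on \<open>(s, s + H]\<close> are negatively
  correlated.\<close> Put \<open>\<Psi>(b) = P(F(b) = 0) = E[exp (-\<lambda> E(b))]\<close> and \<open>v(a) = E[F(a)] = \<lambda> E[E(a)]\<close>. An event of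
  \<open>F\<close> renews the heavy-tailed waiting time, and this leads to
  \<open>P(F(a) = F(b)) \<ge> (1 + v(a)) \<Psi>(b)\<close> for \<open>a \<le> b\<close> (\<open>silent_stretch_lower_bound\<close>). With
  \<open>I(t) = P(G(t) = 0) = E[\<Psi>(M(t))]\<close>, positive correlation for all \<open>s\<close> and \<open>H\<close> would thus say, up to
  the truncation of \<open>v\<close> at a level \<open>K\<close>,
  \<open>I(s) E[v(M(s))] E[\<Psi>(K + M(H))] \<le> (1 - I(s)) I(s + H) \<le> (1 - I(s)) I(H)\<close>.
  Two facts contradict this.

  \<^item> For some small \<open>s\<close> and large \<open>K\<close>, \<open>I(s) E[v(M(s))] > 1 - I(s)\<close> (\<open>small_time_gap\<close>). Indeed
    \<open>E[v(M(s))]\<close> exceeds \<open>1 - I(s)\<close> by at least a multiple of \<open>P(M(s) \<ge> 1)\<close>, which is of order \<open>s\<close>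
    because the jumps of \<open>M\<close> exceed \<open>1\<close> at a positive rate, while \<open>(1 - I(s))\<^sup>2 / I(s)\<close> is \<open>o(s)\<close>.
  \<^item> Hence a fixed shift \<open>K\<close> would reduce \<open>E[\<Psi>(M(H))]\<close> by a fixed factor below \<open>1\<close>, for every \<open>H\<close>. As
    \<open>M\<close> gains more than \<open>K\<close> in a bounded time with high probability, \<open>I\<close> would decay geometrically
    (\<open>shift_not_contracting\<close>). But \<open>\<Psi>(x) \<ge> exp (-v(x))\<close> by Jensen's inequality and \<open>v(x) = O(x\<^sup>\<beta>)\<close>,
    so \<open>\<Psi>\<close> dominates a multiple of every \<open>exp (-\<eta> x)\<close>, and the Laplace transform of \<open>M\<close> shows that \<open>I\<close>
    decays more slowly than any geometric rate (\<open>no_event_not_geometric\<close>).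
\<close>

section \<open>Zero sets under an infinitely divisible law\<close>

text \<open>
  A sum of \<open>m\<close> independent copies of a functional is negative when all of them are, so the copies
  inherit nonnegativity; and a sum of nonnegative terms vanishes exactly when all of them do.
\<close>

lemma convolution_root_zero_set:
  fixes w :: "('i \<Rightarrow> real) \<Rightarrow> real"
  assumes \<kappa>: "prob_space \<kappa>" "sets \<kappa> = sets (PiM I (\<lambda>_. borel))"
    and \<nu>: "\<nu> = distr (PiM {..<m} (\<lambda>_. \<kappa>)) (PiM I (\<lambda>_. borel)) (\<lambda>x. \<lambda>i\<in>I. \<Sum>k<m. x k i)"
    and m: "m \<ge> 1"
    and w [measurable]: "w \<in> borel_measurable (PiM I (\<lambda>_. borel))"
    and add: "\<And>x. w (\<lambda>i\<in>I. \<Sum>k<m. x k i) = (\<Sum>k<m. w (x k))"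
    and nonneg: "AE x in \<nu>. w x \<ge> 0"
  shows "AE x in \<kappa>. w x \<ge> 0"
    and "measure \<nu> {x\<in>space \<nu>. w x = 0} = measure \<kappa> {x\<in>space \<kappa>. w x = 0} ^ m"
proof -
  interpret \<kappa>: prob_space \<kappa> by fact
  interpret Q: finite_product_prob_space "\<lambda>_::nat. \<kappa>" "{..<m}"
    by (unfold_locales) auto
  let ?Q = "PiM {..<m} (\<lambda>_. \<kappa>)"
  have [measurable]: "w \<in> borel_measurable \<kappa>"
    using w by (simp add: measurable_cong_sets[OF \<kappa>(2) refl])
  have comp: "(\<lambda>x. x k i) \<in> borel_measurable ?Q" if "k < m" "i \<in> I" for k i
  proof -
    have "(\<lambda>x. x k) \<in> measurable ?Q \<kappa>"
      by (rule measurable_component_singleton) (use that in simp)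
    moreover have "(\<lambda>y. y i) \<in> borel_measurable \<kappa>"
      using that by (simp add: measurable_cong_sets[OF \<kappa>(2) refl])
    ultimately show ?thesis by (rule measurable_compose)
  qed
  have sm [measurable]: "(\<lambda>x. \<lambda>i\<in>I. \<Sum>k<m. x k i) \<in> measurable ?Q (PiM I (\<lambda>_. borel))"
    by (rule measurable_restrict) (auto intro!: borel_measurable_sum comp)
  have "AE x in ?Q. w (\<lambda>i\<in>I. \<Sum>k<m. x k i) \<ge> 0"
    using nonneg unfolding \<nu> by (subst (asm) AE_distr_iff) auto
  then have AEsum: "AE x in ?Q. (\<Sum>k<m. w (x k)) \<ge> 0" by (simp add: add)
  \<comment> \<open>if one copy were negative with positive probability, so would be all \<open>m\<close> of them at once\<close>
  let ?N = "{x\<in>space \<kappa>. w x < 0}"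
  have "PiE {..<m} (\<lambda>_. ?N) \<in> sets ?Q" by (intro sets_PiM_I_finite) auto
  moreover have "AE x in ?Q. x \<notin> PiE {..<m} (\<lambda>_. ?N)"
    using AEsum
  proof eventually_elim
    case (elim x)
    show ?case
    proof
      assume "x \<in> PiE {..<m} (\<lambda>_. ?N)"
      then have "\<forall>k<m. w (x k) < 0" by (auto simp: PiE_iff)
      then have "(\<Sum>k<m. w (x k)) < 0" using m sum_strict_mono[of "{..<m}" "\<lambda>k. w (x k)" "\<lambda>_. 0"]
        by (auto simp: lessThan_empty_iff)
      then show False using elim by simp
    qed
  qed
  ultimately have "measure ?Q (PiE {..<m} (\<lambda>_. ?N)) = 0"
    by (intro measure_eq_0_null_sets) (simp add: AE_iff_null_sets)
  then have "measure \<kappa> ?N ^ m = 0"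
    by (subst (asm) Q.finite_measure_PiM_emb) auto
  then have "measure \<kappa> ?N = 0" by simp
  then show 1: "AE x in \<kappa>. w x \<ge> 0"
    by (subst AE_iff_measurable[OF _ refl]) (auto simp: not_le \<kappa>.emeasure_eq_measure)
  have AEk: "AE x in ?Q. \<forall>k\<in>{..<m}. w (x k) \<ge> 0"
    by (subst AE_ball_countable) (auto intro!: AE_PiM_component 1 simp: \<kappa>)
  have "measure \<nu> {x\<in>space \<nu>. w x = 0} = measure ?Q {x\<in>space ?Q. w (\<lambda>i\<in>I. \<Sum>k<m. x k i) = 0}"
  proof -
    have "measure \<nu> {x\<in>space \<nu>. w x = 0} = measure ?Q ((\<lambda>x. \<lambda>i\<in>I. \<Sum>k<m. x k i) -`
        {x\<in>space (PiM I (\<lambda>_. borel)). w x = 0} \<inter> space ?Q)"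
      unfolding \<nu> by (subst measure_distr) auto
    also have "(\<lambda>x. \<lambda>i\<in>I. \<Sum>k<m. x k i) -` {x\<in>space (PiM I (\<lambda>_. borel)). w x = 0} \<inter> space ?Q
        = {x\<in>space ?Q. w (\<lambda>i\<in>I. \<Sum>k<m. x k i) = 0}"
      using measurable_space[OF sm] by auto
    finally show ?thesis .
  qed
  also have "\<dots> = measure ?Q (PiE {..<m} (\<lambda>_. {x\<in>space \<kappa>. w x = 0}))"
  proof (rule measure_eq_AE)
    show "AE x in ?Q. (x \<in> {x\<in>space ?Q. w (\<lambda>i\<in>I. \<Sum>k<m. x k i) = 0}) =
        (x \<in> PiE {..<m} (\<lambda>_. {x\<in>space \<kappa>. w x = 0}))"
      using AEk AE_space
    proof eventually_elim
      case (elim x)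
      then have "(\<Sum>k<m. w (x k)) = 0 \<longleftrightarrow> (\<forall>k\<in>{..<m}. w (x k) = 0)"
        by (intro sum_nonneg_eq_0_iff) auto
      then show ?case using elim by (auto simp: add space_PiM PiE_iff)
    qed
  qed (auto intro!: sets_PiM_I_finite)
  also have "\<dots> = measure \<kappa> {x\<in>space \<kappa>. w x = 0} ^ m"
    by (subst Q.finite_measure_PiM_emb) auto
  finally show "measure \<nu> {x\<in>space \<nu>. w x = 0} = measure \<kappa> {x\<in>space \<kappa>. w x = 0} ^ m" .
qed

text \<open>
  With \<open>p = B\<^bsup>1/m\<^esup>\<close> and \<open>q = C\<^bsup>1/m\<^esup>\<close> the hypothesis reads \<open>(B\<^bsup>1/m\<^esup> + C\<^bsup>1/m\<^esup> - 1)\<^sup>m \<le> D\<close>, and the left-hand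
  side tends to \<open>exp (ln B + ln C)\<close>.
\<close>

lemma mult_le_if_roots_superadditive:
  fixes B C D :: real
  assumes "B > 0" "C > 0" "D \<ge> 0"
    and root: "\<And>m::nat. m \<ge> 1 \<Longrightarrow> \<exists>p q r. p \<ge> 0 \<and> q \<ge> 0 \<and> r \<ge> p + q - 1 \<and> p ^ m = B \<and> q ^ m = C \<and> r ^ m = D"
  shows "B * C \<le> D"
proof (rule tendsto_upperbound)
  show "((\<lambda>m::nat. (B powr (1 / m) + C powr (1 / m) - 1) powr m) \<longlongrightarrow> B * C) sequentially"
    using assms(1,2) by (real_asymp simp: exp_add)
  have lim: "((\<lambda>m::nat. B powr (1 / m) + C powr (1 / m) - 1) \<longlongrightarrow> 1) sequentially"
    using assms(1,2) by real_asymp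
  show "\<forall>\<^sub>F m::nat in sequentially. (B powr (1 / m) + C powr (1 / m) - 1) powr m \<le> D"
    using order_tendstoD(1)[OF lim, of 0, simplified] eventually_ge_at_top[of 1]
  proof eventually_elim
    case (elim m)
    then obtain p q r where pqr: "p \<ge> 0" "q \<ge> 0" "r \<ge> p + q - 1" "p ^ m = B" "q ^ m = C" "r ^ m = D"
      using root by blast
    have pp: "x powr (1 / m) = y" if "y \<ge> 0" "y ^ m = x" "x > 0" for x y :: real
    proof -
      have "y > 0" using that elim by (cases "y = 0") (auto simp: power_0_left)
      have "x powr (1/m) = (y powr m) powr (1/m)" using that \<open>y > 0\<close> by (simp add: powr_realpow)
      also have "\<dots> = y" unfolding powr_powr using elim \<open>y > 0\<close> by simp
      finally show ?thesis .
    qed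
    have eq: "B powr (1 / m) = p" "C powr (1 / m) = q" using pp pqr assms by auto
    have "(p + q - 1) powr m = (p + q - 1) ^ m" using elim unfolding eq by (simp add: powr_realpow)
    also have "\<dots> \<le> r ^ m" using elim pqr unfolding eq by (intro power_mono) auto
    finally show ?case using pqr eq by simp
  qed
qed simp

text \<open>
  The event that both functionals vanish is the zero set of their sum, so the root formula applies
  to all three probabilities. For the law of one summand, inclusion-exclusion gives \<open>r \<ge> p + q - 1\<close>.
\<close>

lemma infinitely_divisible_zero_sets_positively_correlated:
  fixes u v :: "('i \<Rightarrow> real) \<Rightarrow> real"
  assumes id: "infinitely_divisible I \<nu>"
    and [measurable]: "u \<in> borel_measurable (PiM I (\<lambda>_. borel))" "v \<in> borel_measurable (PiM I (\<lambda>_. borel))"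
    and add: "\<And>m x. u (\<lambda>i\<in>I. \<Sum>k<(m::nat). x k i) = (\<Sum>k<m. u (x k))"
             "\<And>m x. v (\<lambda>i\<in>I. \<Sum>k<(m::nat). x k i) = (\<Sum>k<m. v (x k))"
    and nonneg: "AE x in \<nu>. u x \<ge> 0" "AE x in \<nu>. v x \<ge> 0"
  shows "measure \<nu> {x\<in>space \<nu>. u x = 0} * measure \<nu> {x\<in>space \<nu>. v x = 0}
    \<le> measure \<nu> {x\<in>space \<nu>. u x = 0 \<and> v x = 0}" (is "?B * ?C \<le> ?D")
proof (cases "?B > 0 \<and> ?C > 0")
  case True
  show ?thesis
  proof (rule mult_le_if_roots_superadditive)
    fix m :: nat assume m: "m \<ge> 1"
    then obtain \<kappa> where \<kappa>: "prob_space \<kappa>" "sets \<kappa> = sets (PiM I (\<lambda>_. borel))"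
      and \<nu>: "\<nu> = distr (PiM {..<m} (\<lambda>_. \<kappa>)) (PiM I (\<lambda>_. borel)) (\<lambda>x. \<lambda>i\<in>I. \<Sum>k<m. x k i)"
      using id unfolding infinitely_divisible_def by blast
    interpret \<kappa>: prob_space \<kappa> by fact
    have [measurable]: "u \<in> borel_measurable \<kappa>" "v \<in> borel_measurable \<kappa>"
      by (simp_all add: measurable_cong_sets[OF \<kappa>(2) refl])
    have "AE x in \<nu>. u x + v x \<ge> 0" using nonneg by eventually_elim auto
    note U = convolution_root_zero_set[OF \<kappa> \<nu> m _ add(1) nonneg(1)]
      and V = convolution_root_zero_set[OF \<kappa> \<nu> m _ add(2) nonneg(2)]
      and W = convolution_root_zero_set[OF \<kappa> \<nu> m _ _ this]
    have setsN: "sets \<nu> = sets (PiM I (\<lambda>_. borel))" by (simp add: \<nu>)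
    have [measurable]: "u \<in> borel_measurable \<nu>" "v \<in> borel_measurable \<nu>"
      by (simp_all add: measurable_cong_sets[OF setsN refl])
    let ?p = "measure \<kappa> {x\<in>space \<kappa>. u x = 0}" and ?q = "measure \<kappa> {x\<in>space \<kappa>. v x = 0}"
    let ?r = "measure \<kappa> {x\<in>space \<kappa>. u x + v x = 0}"
    have "?D = measure \<nu> {x\<in>space \<nu>. u x + v x = 0}"
      by (rule measure_eq_AE) (use nonneg in \<open>auto elim!: eventually_elim2\<close>)
    also have "\<dots> = ?r ^ m"
      by (rule W(2)) (auto simp: add sum.distrib)
    finally have r: "?r ^ m = ?D" ..
    have "?r = measure \<kappa> ({x\<in>space \<kappa>. u x = 0} \<inter> {x\<in>space \<kappa>. v x = 0})"
      by (rule measure_eq_AE) (use U(1) V(1) in \<open>auto elim!: eventually_elim2\<close>)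
    also have "\<dots> \<ge> ?p + ?q - 1"
    proof -
      have "measure \<kappa> ({x\<in>space \<kappa>. u x = 0} \<union> {x\<in>space \<kappa>. v x = 0})
         = ?p + ?q - measure \<kappa> ({x\<in>space \<kappa>. u x = 0} \<inter> {x\<in>space \<kappa>. v x = 0})"
        by (rule measure_Un3) (auto simp: \<kappa>.fmeasurable_eq_sets)
      moreover have "measure \<kappa> ({x\<in>space \<kappa>. u x = 0} \<union> {x\<in>space \<kappa>. v x = 0}) \<le> 1"
        by (rule \<kappa>.prob_le_1)
      ultimately show ?thesis by linarith
    qed
    finally have "?r \<ge> ?p + ?q - 1" .
    moreover have "?p ^ m = ?B" "?q ^ m = ?C" using U(2) V(2) by auto
    ultimately show "\<exists>p q r. p \<ge> 0 \<and> q \<ge> 0 \<and> r \<ge> p + q - 1 \<and> p ^ m = ?B \<and> q ^ m = ?C \<and> r ^ m = ?D"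
      using r by (intro exI[of _ ?p] exI[of _ ?q] exI[of _ ?r]) auto
  qed (use True in auto)
next
  case False
  then have "?B * ?C = 0" using measure_nonneg[of \<nu>] by (auto simp: not_less order.antisym)
  then show ?thesis by (metis measure_nonneg)
qed

section \<open>Evaluating a process at independent random times\<close>

text \<open>
  Rounding up, strictly, to the grid of mesh \<open>1 / (k + 1)\<close>: approaching a random time from the right
  through countably many values keeps a right-continuous process under control without joint
  measurability in time and sample point. The truncation by \<^term>\<open>nat\<close> makes the grid countable and
  contained in the nonnegative reals.
\<close>

definition grid_above :: "nat \<Rightarrow> real \<Rightarrow> real" where
  "grid_above k y = real (nat \<lfloor>y * real (Suc k)\<rfloor> + 1) / real (Suc k)"

lemma grid_above_nonneg: "grid_above k y \<ge> 0"
  by (simp add: grid_above_def)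

lemma grid_above_gt:
  assumes "y \<ge> 0" shows "grid_above k y > y"
proof -
  have "y * real (Suc k) < real (nat \<lfloor>y * real (Suc k)\<rfloor> + 1)"
    using assms by (simp add: of_nat_nat) linarith
  then show ?thesis unfolding grid_above_def by (subst pos_less_divide_eq) auto
qed

lemma grid_above_le:
  assumes "y \<ge> 0" shows "grid_above k y \<le> y + 1 / real (Suc k)"
proof -
  have "real (nat \<lfloor>y * real (Suc k)\<rfloor> + 1) \<le> y * real (Suc k) + 1"
    using assms by (simp add: of_nat_nat)
  then have "grid_above k y \<le> (y * real (Suc k) + 1) / real (Suc k)"
    unfolding grid_above_def by (intro divide_right_mono) auto
  also have "\<dots> = y + 1 / real (Suc k)" by (simp add: field_simps del: of_nat_Suc)
  finally show ?thesis .
qed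

lemma grid_above_at_right:
  assumes "y \<ge> 0" shows "filterlim (\<lambda>k. grid_above k y) (at_right y) sequentially"
  unfolding filterlim_at
proof
  show "(\<lambda>k. grid_above k y) \<longlonglongrightarrow> y"
  proof (rule tendsto_sandwich[OF _ _ tendsto_const])
    show "(\<lambda>k. y + 1 / real (Suc k)) \<longlonglongrightarrow> y" by real_asymp
  qed (use assms in \<open>auto intro!: always_eventually less_imp_le[OF grid_above_gt] grid_above_le simp del: of_nat_Suc\<close>)
qed (use grid_above_gt[OF assms] in \<open>auto intro!: always_eventually simp: less_imp_neq[THEN not_sym]\<close>)

lemma grid_above_eval_measurable:
  assumes T: "T \<in> borel_measurable M" and X: "\<And>r. r \<ge> 0 \<Longrightarrow> X r \<in> borel_measurable M"
  shows "(\<lambda>\<omega>. X (grid_above k (T \<omega>)) \<omega>) \<in> borel_measurable M"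
  unfolding grid_above_def
proof (rule measurable_compose_countable[where f = "\<lambda>i \<omega>. X (real (i + 1) / real (Suc k)) \<omega>" and
      g = "\<lambda>\<omega>. nat \<lfloor>T \<omega> * real (Suc k)\<rfloor>"])
  show "(\<lambda>\<omega>. nat \<lfloor>T \<omega> * real (Suc k)\<rfloor>) \<in> measurable M (count_space UNIV)"
    using T by measurable
qed (rule X, simp)

context prob_space
begin

context
  fixes T X :: "real \<Rightarrow> 'a \<Rightarrow> real"
  assumes ind: "indep_var (PiM {0..} (\<lambda>_. borel)) (\<lambda>\<omega>. \<lambda>t\<in>{0..}. T t \<omega>)
      (PiM {0..} (\<lambda>_. borel)) (\<lambda>\<omega>. \<lambda>t\<in>{0..}. X t \<omega>)"
    and T_nonneg: "\<And>t \<omega>. t \<ge> 0 \<Longrightarrow> \<omega> \<in> space M \<Longrightarrow> T t \<omega> \<ge> 0"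
    and X_right: "\<And>t \<omega>. t \<ge> 0 \<Longrightarrow> \<omega> \<in> space M \<Longrightarrow> continuous (at_right t) (\<lambda>t. X t \<omega>)"
begin

lemma time_change_components_measurable:
  assumes "t \<ge> 0"
  shows "T t \<in> borel_measurable M" "X t \<in> borel_measurable M"
proof -
  have "(\<lambda>x. x t) \<in> borel_measurable (PiM {0..} (\<lambda>_. borel :: real measure))"
    by (rule measurable_component_singleton) (use assms in simp)
  from measurable_compose[OF indep_var_rv1[OF ind] this] measurable_compose[OF indep_var_rv2[OF ind] this]
  show "T t \<in> borel_measurable M" "X t \<in> borel_measurable M" using assms by simp_all
qed

lemma time_change_approx:
  assumes "t \<ge> 0" "\<omega> \<in> space M" "\<omega>' \<in> space M"
  shows "(\<lambda>k. X (grid_above k (T t \<omega>)) \<omega>') \<longlonglongrightarrow> X (T t \<omega>) \<omega>'"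
  using X_right[of "T t \<omega>" \<omega>'] T_nonneg[of t \<omega>] assms
  by (auto simp: continuous_within intro: filterlim_compose grid_above_at_right)

lemma independent_time_change_measurable:
  assumes "t \<ge> 0"
  shows "(\<lambda>\<omega>. X (T t \<omega>) \<omega>) \<in> borel_measurable M"
  by (rule borel_measurable_LIMSEQ_real[OF time_change_approx[OF assms]])
     (auto intro!: grid_above_eval_measurable time_change_components_measurable assms)

text \<open>
  Independence is a statement about the product sigma-algebras, on which evaluation at a random time is
  not measurable. On the grid it is, so Fubini's theorem applies there, and right-continuity together
  with dominated convergence removes the grid. Measurability of the conditional expectation comes out
  of the same limit.
\<close>

lemma expectation_independent_time_change:
  fixes f :: "real \<Rightarrow> real \<Rightarrow> real"
  assumes f: "continuous_on UNIV (\<lambda>p. f (fst p) (snd p))" and B: "\<And>x y. \<bar>f x y\<bar> \<le> B"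
    and s: "s \<ge> 0" and t: "t \<ge> 0"
  shows "expectation (\<lambda>\<omega>. f (X (T s \<omega>) \<omega>) (X (T t \<omega>) \<omega>)) =
      expectation (\<lambda>\<omega>. expectation (\<lambda>\<omega>'. f (X (T s \<omega>) \<omega>') (X (T t \<omega>) \<omega>')))"
    and "(\<lambda>\<omega>. expectation (\<lambda>\<omega>'. f (X (T s \<omega>) \<omega>') (X (T t \<omega>) \<omega>'))) \<in> borel_measurable M"
proof -
  let ?S = "PiM {0::real..} (\<lambda>_. borel :: real measure)"
  let ?Tp = "\<lambda>\<omega>. \<lambda>t\<in>{0..}. T t \<omega>" and ?Xp = "\<lambda>\<omega>. \<lambda>t\<in>{0..}. X t \<omega>"
  have rvT [measurable]: "?Tp \<in> measurable M ?S" and rvX [measurable]: "?Xp \<in> measurable M ?S"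
    using indep_var_rv1[OF ind] indep_var_rv2[OF ind] by auto
  have f_borel: "(\<lambda>p. f (fst p) (snd p)) \<in> borel_measurable borel"
    using f by (rule borel_measurable_continuous_onI)
  have f_meas: "(\<lambda>x. f (a x) (b x)) \<in> borel_measurable N"
    if "a \<in> borel_measurable N" "b \<in> borel_measurable N" for a b and N :: "'z measure"
    using measurable_compose[OF borel_measurable_Pair[OF that] f_borel] by simp
  have f_lim: "(\<lambda>k. f (a k) (b k)) \<longlonglongrightarrow> f x y" if "a \<longlonglongrightarrow> x" "b \<longlonglongrightarrow> y" for a b x y
  proof -
    have "isCont (\<lambda>p. f (fst p) (snd p)) (x, y)"
      using f by (simp add: continuous_on_eq_continuous_at)
    from isCont_tendsto_compose[OF this tendsto_Pair[OF that]] show ?thesis by simp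
  qed
  define d where "d = grid_above"
  have d0: "d k y \<ge> 0" for k y by (simp add: d_def grid_above_nonneg)
  let ?F = "\<lambda>k (m, x). f (x (d k (m s))) (x (d k (m t)))"
  have F_meas [measurable]: "?F k \<in> borel_measurable (?S \<Otimes>\<^sub>M ?S)" for k
    unfolding split_beta d_def
    by (intro f_meas grid_above_eval_measurable[where X = "\<lambda>r p. snd p r"])
       (use s t in \<open>auto intro!: measurable_compose[OF measurable_fst] measurable_compose[OF measurable_snd]\<close>)
  let ?A = "distr M ?S ?Tp" and ?B = "distr M ?S ?Xp"
  interpret A: prob_space ?A by (rule prob_space_distr) simp
  interpret B: prob_space ?B by (rule prob_space_distr) simp
  interpret AB: pair_prob_space ?A ?B ..
  let ?h = "\<lambda>k m. expectation (\<lambda>\<omega>'. f (X (d k (m s)) \<omega>') (X (d k (m t)) \<omega>'))"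
  have h_eq: "(\<integral>x. ?F k (m, x) \<partial>?B) = ?h k m" if "m \<in> space ?S" for k m
  proof -
    have "(\<lambda>x. ?F k (m, x)) \<in> borel_measurable ?S"
      using measurable_compose[OF measurable_Pair1'[OF that] F_meas] by simp
    then show ?thesis by (subst integral_distr) (auto simp: d0)
  qed
  have "(\<lambda>m. \<integral>x. ?F k (m, x) \<partial>?B) \<in> borel_measurable ?S" for k
    by (intro B.borel_measurable_lebesgue_integral) simp
  then have h_meas0: "?h k \<in> borel_measurable ?S" for k
    by (subst (asm) measurable_cong[OF h_eq]) auto
  have h_meas: "(\<lambda>\<omega>. expectation (\<lambda>\<omega>'. f (X (d k (T s \<omega>)) \<omega>') (X (d k (T t \<omega>)) \<omega>'))) \<in> borel_measurable M" for k
    using measurable_compose[OF rvT h_meas0[of k]] s t by simp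
  have discrete: "expectation (\<lambda>\<omega>. f (X (d k (T s \<omega>)) \<omega>) (X (d k (T t \<omega>)) \<omega>)) =
     expectation (\<lambda>\<omega>. expectation (\<lambda>\<omega>'. f (X (d k (T s \<omega>)) \<omega>') (X (d k (T t \<omega>)) \<omega>')))" for k
  proof -
    have "expectation (\<lambda>\<omega>. f (X (d k (T s \<omega>)) \<omega>) (X (d k (T t \<omega>)) \<omega>)) =
        expectation (\<lambda>\<omega>. ?F k (?Tp \<omega>, ?Xp \<omega>))"
      using s t by (simp add: d0)
    also have "\<dots> = integral\<^sup>L (distr M (?S \<Otimes>\<^sub>M ?S) (\<lambda>\<omega>. (?Tp \<omega>, ?Xp \<omega>))) (?F k)"
      by (rule integral_distr[symmetric]) simp_all
    also have "distr M (?S \<Otimes>\<^sub>M ?S) (\<lambda>\<omega>. (?Tp \<omega>, ?Xp \<omega>)) = ?A \<Otimes>\<^sub>M ?B"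
      using ind unfolding indep_var_distribution_eq by simp
    also have "integral\<^sup>L (?A \<Otimes>\<^sub>M ?B) (?F k) = (\<integral>m. (\<integral>x. ?F k (m, x) \<partial>?B) \<partial>?A)"
    proof (rule AB.integral_fst'[symmetric], rule AB.integrable_const_bound[where B = B])
      show "?F k \<in> borel_measurable (?A \<Otimes>\<^sub>M ?B)" using F_meas[of k] by simp
    qed (use B in \<open>auto simp: split_beta\<close>)
    also have "\<dots> = (\<integral>m. ?h k m \<partial>?A)"
      by (rule Bochner_Integration.integral_cong[OF refl]) (rule h_eq, simp)
    also have "\<dots> = expectation (\<lambda>\<omega>. ?h k (?Tp \<omega>))"
      by (rule integral_distr) (auto intro: h_meas0)
    finally show ?thesis using s t by simp
  qed
  have X_meas: "X r \<in> borel_measurable M" if "r \<ge> 0" for r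
    using time_change_components_measurable that by simp
  have inner: "(\<lambda>k. expectation (\<lambda>\<omega>'. f (X (d k (T s \<omega>)) \<omega>') (X (d k (T t \<omega>)) \<omega>')))
      \<longlonglongrightarrow> expectation (\<lambda>\<omega>'. f (X (T s \<omega>) \<omega>') (X (T t \<omega>) \<omega>'))" if "\<omega> \<in> space M" for \<omega>
  proof (rule integral_dominated_convergence[where w = "\<lambda>_. B"])
    show "AE \<omega>' in M. (\<lambda>k. f (X (d k (T s \<omega>)) \<omega>') (X (d k (T t \<omega>)) \<omega>'))
        \<longlonglongrightarrow> f (X (T s \<omega>) \<omega>') (X (T t \<omega>) \<omega>')"
      unfolding d_def by (rule AE_I2) (intro f_lim time_change_approx that s t)
  qed (use B d0 T_nonneg s t that in \<open>auto intro!: f_meas X_meas\<close>)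
  show inner_meas: "(\<lambda>\<omega>. expectation (\<lambda>\<omega>'. f (X (T s \<omega>) \<omega>') (X (T t \<omega>) \<omega>'))) \<in> borel_measurable M"
    by (rule borel_measurable_LIMSEQ_real[OF inner h_meas])
  have dX_meas: "(\<lambda>\<omega>. X (d k (T r \<omega>)) \<omega>) \<in> borel_measurable M" if "r \<ge> 0" for k r
    unfolding d_def by (rule grid_above_eval_measurable) (use that time_change_components_measurable in auto)
  have "(\<lambda>k. expectation (\<lambda>\<omega>. f (X (d k (T s \<omega>)) \<omega>) (X (d k (T t \<omega>)) \<omega>)))
      \<longlonglongrightarrow> expectation (\<lambda>\<omega>. f (X (T s \<omega>) \<omega>) (X (T t \<omega>) \<omega>))"
  proof (rule integral_dominated_convergence[where w = "\<lambda>_. B"])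
    show "AE \<omega> in M. (\<lambda>k. f (X (d k (T s \<omega>)) \<omega>) (X (d k (T t \<omega>)) \<omega>))
        \<longlonglongrightarrow> f (X (T s \<omega>) \<omega>) (X (T t \<omega>) \<omega>)"
      unfolding d_def by (rule AE_I2) (intro f_lim time_change_approx s t)
    show "(\<lambda>\<omega>. f (X (d k (T s \<omega>)) \<omega>) (X (d k (T t \<omega>)) \<omega>)) \<in> borel_measurable M" for k
      by (intro f_meas dX_meas s t)
    show "(\<lambda>\<omega>. f (X (T s \<omega>) \<omega>) (X (T t \<omega>) \<omega>)) \<in> borel_measurable M"
      by (intro f_meas independent_time_change_measurable s t)
  qed (use B in auto)
  moreover have "(\<lambda>k. expectation (\<lambda>\<omega>. expectation (\<lambda>\<omega>'. f (X (d k (T s \<omega>)) \<omega>') (X (d k (T t \<omega>)) \<omega>'))))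
      \<longlonglongrightarrow> expectation (\<lambda>\<omega>. expectation (\<lambda>\<omega>'. f (X (T s \<omega>) \<omega>') (X (T t \<omega>) \<omega>')))"
  proof (rule integral_dominated_convergence[where w = "\<lambda>_. B"])
    show "AE \<omega> in M. (\<lambda>k. expectation (\<lambda>\<omega>'. f (X (d k (T s \<omega>)) \<omega>') (X (d k (T t \<omega>)) \<omega>')))
        \<longlonglongrightarrow> expectation (\<lambda>\<omega>'. f (X (T s \<omega>) \<omega>') (X (T t \<omega>) \<omega>'))"
      by (rule AE_I2) (rule inner)
    have "\<bar>expectation (\<lambda>\<omega>'. f (X (d k (T s \<omega>)) \<omega>') (X (d k (T t \<omega>)) \<omega>'))\<bar> \<le> B" for k \<omega>
    proof -
      let ?Y = "\<lambda>\<omega>'. f (X (d k (T s \<omega>)) \<omega>') (X (d k (T t \<omega>)) \<omega>')"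
      have Y: "integrable M ?Y"
        using B by (intro integrable_const_bound[where B = B] f_meas X_meas d0) auto
      have "?Y \<omega>' \<le> B" "- B \<le> ?Y \<omega>'" for \<omega>'
        using B[of "X (d k (T s \<omega>)) \<omega>'" "X (d k (T t \<omega>)) \<omega>'"] by auto
      then show ?thesis
        using integral_le_const[OF Y, of B] integral_ge_const[OF Y, of "- B"] by (simp add: abs_le_iff)
    qed
    then show "AE \<omega> in M. norm (expectation (\<lambda>\<omega>'. f (X (d k (T s \<omega>)) \<omega>') (X (d k (T t \<omega>)) \<omega>'))) \<le> B" for k
      by simp
  qed (auto intro: h_meas inner_meas)
  ultimately show "expectation (\<lambda>\<omega>. f (X (T s \<omega>) \<omega>) (X (T t \<omega>) \<omega>)) =
      expectation (\<lambda>\<omega>. expectation (\<lambda>\<omega>'. f (X (T s \<omega>) \<omega>') (X (T t \<omega>) \<omega>')))"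
    unfolding discrete by (rule LIMSEQ_unique)
qed

end

end

section \<open>Increments of Levy processes and paths of inverse subordinators\<close>

lemma levy_process_increment:
  assumes "prob_space P" "levy_process P X" "s \<ge> 0" "h \<ge> 0"
  shows "prob_space.indep_var P borel (X s) borel (\<lambda>\<omega>. X (s + h) \<omega> - X s \<omega>)"
    and "distr P borel (\<lambda>\<omega>. X (s + h) \<omega> - X s \<omega>) = distr P borel (X h)"
proof -
  interpret prob_space P by fact
  note L = assms(2)[unfolded levy_process_def]
  have [measurable]: "X s \<in> borel_measurable P" using L assms by auto
  show "distr P borel (\<lambda>\<omega>. X (s + h) \<omega> - X s \<omega>) = distr P borel (X h)"
    using L assms by auto
  have [measurable]: "X (s + h) \<in> borel_measurable P" using L assms by auto
  \<comment> \<open>the increment over \<open>[0, s]\<close> is \<open>X s\<close> itself because paths start at 0\<close>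
  define ts where "ts = (\<lambda>i::nat. if i = 0 then 0 else if i = 1 then s else s + h)"
  have "0 \<le> ts 0 \<and> (\<forall>i<2. ts i \<le> ts (Suc i))"
    using assms by (auto simp: ts_def less_2_cases_iff)
  then have "indep_vars (\<lambda>_. borel) (\<lambda>i \<omega>. X (ts (Suc i)) \<omega> - X (ts i) \<omega>) {..<2}"
    using L by blast
  from indep_var_restrict[OF this, of "{0}" "{1}"]
  have "indep_var (PiM {0::nat} (\<lambda>_. borel)) (\<lambda>\<omega>. \<lambda>i\<in>{0}. X (ts (Suc i)) \<omega> - X (ts i) \<omega>)
      (PiM {1::nat} (\<lambda>_. borel)) (\<lambda>\<omega>. \<lambda>i\<in>{1}. X (ts (Suc i)) \<omega> - X (ts i) \<omega>)"
    by auto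
  from indep_var_compose[OF this measurable_component_singleton[of 0] measurable_component_singleton[of 1]]
  have ind: "indep_var borel (\<lambda>\<omega>. X s \<omega> - X 0 \<omega>) borel (\<lambda>\<omega>. X (s + h) \<omega> - X s \<omega>)"
    by (simp add: ts_def comp_def)
  have "indep_var borel (\<lambda>\<omega>. X s \<omega> - X 0 \<omega>) borel (\<lambda>\<omega>. X (s + h) \<omega> - X s \<omega>)
      = indep_var borel (X s) borel (\<lambda>\<omega>. X (s + h) \<omega> - X s \<omega>)"
  proof -
    have *: "X s \<omega> - X 0 \<omega> = X s \<omega>" if "\<omega> \<in> space P" for \<omega> using L that by simp
    have "distr P borel (\<lambda>\<omega>. X s \<omega> - X 0 \<omega>) = distr P borel (X s)"
      by (rule distr_cong) (simp_all add: *)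
    moreover have "distr P (borel \<Otimes>\<^sub>M borel) (\<lambda>\<omega>. (X s \<omega> - X 0 \<omega>, X (s + h) \<omega> - X s \<omega>))
        = distr P (borel \<Otimes>\<^sub>M borel) (\<lambda>\<omega>. (X s \<omega>, X (s + h) \<omega> - X s \<omega>))"
      by (rule distr_cong) (simp_all add: *)
    moreover have "(\<lambda>\<omega>. X s \<omega> - X 0 \<omega>) \<in> borel_measurable P"
      using indep_var_rv1[OF ind] .
    ultimately show ?thesis unfolding indep_var_distribution_eq by simp
  qed
  with ind show "indep_var borel (X s) borel (\<lambda>\<omega>. X (s + h) \<omega> - X s \<omega>)" by simp
qed

lemma levy_process_prob_increment:
  assumes "prob_space P" "levy_process P X" "s \<ge> 0" "h \<ge> 0" and A [measurable]: "A \<in> sets borel" "B \<in> sets borel"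
  shows "measure P {\<omega>\<in>space P. X s \<omega> \<in> A \<and> X (s + h) \<omega> - X s \<omega> \<in> B} =
    measure P {\<omega>\<in>space P. X s \<omega> \<in> A} * measure P {\<omega>\<in>space P. X h \<omega> \<in> B}"
proof -
  interpret prob_space P by fact
  note inc = levy_process_increment[OF assms(1-4)]
  have [measurable]: "X h \<in> borel_measurable P" "X (s + h) \<in> borel_measurable P" "X s \<in> borel_measurable P"
    using assms by (auto simp: levy_process_def)
  have "measure P {\<omega>\<in>space P. X s \<omega> \<in> A \<and> X (s + h) \<omega> - X s \<omega> \<in> B} =
    measure P {\<omega>\<in>space P. X s \<omega> \<in> A} * measure P {\<omega>\<in>space P. X (s + h) \<omega> - X s \<omega> \<in> B}"
    by (rule prob_indep_random_variable[OF inc(1)]) simp_all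
  also have "measure P {\<omega>\<in>space P. X (s + h) \<omega> - X s \<omega> \<in> B} = measure (distr P borel (\<lambda>\<omega>. X (s + h) \<omega> - X s \<omega>)) B"
    by (subst measure_distr) (auto intro!: arg_cong[where f = "measure P"])
  also have "\<dots> = measure P {\<omega>\<in>space P. X h \<omega> \<in> B}"
    unfolding inc(2) by (subst measure_distr) (auto intro!: arg_cong[where f = "measure P"])
  finally show ?thesis .
qed

lemma subordinator_path:
  assumes "subordinator P X" "\<omega> \<in> space P"
  shows "X 0 \<omega> = 0" "mono_on {0..} (\<lambda>t. X t \<omega>)" "0 \<le> r \<Longrightarrow> r \<le> t \<Longrightarrow> X r \<omega> \<le> X t \<omega>" "t \<ge> 0 \<Longrightarrow> X t \<omega> \<ge> 0"
proof -
  show "X 0 \<omega> = 0" and m: "mono_on {0..} (\<lambda>t. X t \<omega>)"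
    using assms by (auto simp: subordinator_def levy_process_def)
  show *: "0 \<le> r \<Longrightarrow> r \<le> t \<Longrightarrow> X r \<omega> \<le> X t \<omega>" for r t
    using mono_onD[OF m] by auto
  show "t \<ge> 0 \<Longrightarrow> X t \<omega> \<ge> 0" using *[of 0 t] \<open>X 0 \<omega> = 0\<close> by simp
qed

lemma inverse_subordinator_nonneg: "inverse_subordinator S t \<omega> \<ge> 0"
  by (auto simp: inverse_subordinator_def intro: cInf_greatest)

lemma inverse_subordinator_le:
  assumes "r \<ge> 0" "S r \<omega> > t"
  shows "inverse_subordinator S t \<omega> \<le> r"
proof -
  have "Inf {r. 0 \<le> r \<and> S r \<omega> > t} \<le> r"
    by (rule cInf_lower) (use assms in \<open>auto intro!: bdd_belowI[of _ 0]\<close>)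
  moreover have "\<exists>r\<ge>0. S r \<omega> > t" using assms by blast
  ultimately show ?thesis unfolding inverse_subordinator_def by (simp only: if_True)
qed

lemma inverse_subordinator_less:
  assumes m: "mono_on {0..} (\<lambda>t. S t \<omega>)" and "\<exists>r\<ge>0. S r \<omega> > t" "inverse_subordinator S t \<omega> < r"
  shows "S r \<omega> > t"
proof -
  have "Inf {r. 0 \<le> r \<and> S r \<omega> > t} < r" using assms by (simp add: inverse_subordinator_def)
  then obtain q where "0 \<le> q" "S q \<omega> > t" "q < r"
    using assms(2) by (subst (asm) cInf_less_iff) (auto intro!: bdd_belowI[of _ 0])
  then show ?thesis using mono_onD[OF m, of q r] by auto
qed

lemma inverse_subordinator_mono:
  assumes "a \<le> b" "\<exists>r\<ge>0. S r \<omega> > b"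
  shows "inverse_subordinator S a \<omega> \<le> inverse_subordinator S b \<omega>"
proof -
  have "\<exists>r\<ge>0. S r \<omega> > a" using assms by force
  moreover have "Inf {r. 0 \<le> r \<and> S r \<omega> > a} \<le> Inf {r. 0 \<le> r \<and> S r \<omega> > b}"
    using assms by (intro cInf_superset_mono) (auto intro!: bdd_belowI[of _ 0])
  ultimately show ?thesis using assms by (simp add: inverse_subordinator_def)
qed

text \<open>
  Both statements hold for every path. Where the level \<open>a\<close> is never exceeded, the same is true of all
  higher levels, and the inverse is constantly its default value \<open>0\<close>.
\<close>

lemma inverse_subordinator_from_right:
  "((\<lambda>t. inverse_subordinator S t \<omega>) \<longlongrightarrow> inverse_subordinator S a \<omega>) (at_right a)"
  "\<forall>\<^sub>F t in at_right a. inverse_subordinator S a \<omega> \<le> inverse_subordinator S t \<omega>"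
proof -
  let ?E = "\<lambda>t. inverse_subordinator S t \<omega>"
  have *: "\<forall>\<^sub>F t in at_right a. ?E a \<le> ?E t \<and> ?E t < ?E a + e" if "e > 0" for e
  proof (cases "\<exists>r\<ge>0. S r \<omega> > a")
    case True
    have "Inf {r. 0 \<le> r \<and> S r \<omega> > a} < ?E a + e" using True that by (simp add: inverse_subordinator_def)
    then obtain r where r: "0 \<le> r" "S r \<omega> > a" "r < ?E a + e"
      using True by (subst (asm) cInf_less_iff) (auto intro!: bdd_belowI[of _ 0])
    have "\<forall>\<^sub>F t in at_right a. t \<in> {a<..<S r \<omega>}"
      using r by (intro eventually_at_right_real) auto
    then show ?thesis
    proof eventually_elim
      case (elim t)
      then have "?E t \<le> r" using r by (intro inverse_subordinator_le) auto
      moreover have "?E a \<le> ?E t" using elim r by (intro inverse_subordinator_mono) auto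
      ultimately show ?case using r by auto
    qed
  next
    case False
    have "\<forall>\<^sub>F t in at_right a. t > a" by (simp add: eventually_at_right_less)
    then show ?thesis
    proof eventually_elim
      case (elim t)
      then have "\<not> (\<exists>r\<ge>0. S r \<omega> > t)" using False by force
      then have "?E t = 0" "?E a = 0"
        unfolding inverse_subordinator_def using False by (simp_all only: if_False)
      then show ?case using that by simp
    qed
  qed
  show "\<forall>\<^sub>F t in at_right a. ?E a \<le> ?E t" using *[of 1] by (rule eventually_mono) auto
  show "(?E \<longlongrightarrow> ?E a) (at_right a)"
  proof (rule order_tendstoI)
    fix y assume "y < ?E a"
    then show "\<forall>\<^sub>F t in at_right a. y < ?E t" by (rule_tac eventually_mono[OF *[of 1]]) auto
  next
    fix y assume "?E a < y"
    then show "\<forall>\<^sub>F t in at_right a. ?E t < y" by (rule_tac eventually_mono[OF *[of "y - ?E a"]]) auto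
  qed
qed

text \<open>
  The inverse may stay constant to the right of \<open>a\<close>, so \<open>f\<close> has to be continuous along
  \<^term>\<open>{inverse_subordinator S a \<omega>..}\<close> with the left end point included.
\<close>

lemma cadlag_inverse_subordinator_right_continuous:
  fixes S :: "real \<Rightarrow> 'w \<Rightarrow> real"
  assumes "cadlag f" "a \<ge> 0"
  shows "continuous (at_right a) (\<lambda>t. f (inverse_subordinator S t \<omega>))"
proof -
  let ?e = "inverse_subordinator S a \<omega>"
  have "continuous (at_right ?e) f" using assms(1) inverse_subordinator_nonneg[of S a \<omega>] unfolding cadlag_def by blast
  then have "continuous (at ?e within {?e..}) f" by (simp only: at_within_Ici_at_right)
  moreover have "\<forall>\<^sub>F t in at_right a. inverse_subordinator S t \<omega> \<in> {?e..}"
    using inverse_subordinator_from_right(2)[where S = S and \<omega> = \<omega> and a = a] by simp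
  ultimately have "((\<lambda>t. f (inverse_subordinator S t \<omega>)) \<longlongrightarrow> f ?e) (at_right a)"
    using inverse_subordinator_from_right(1) by (rule continuous_within_tendsto_compose)
  then show ?thesis by (simp add: continuous_within)
qed

lemma indep_processes_sym:
  assumes "prob_space P" "indep_processes P X Y" shows "indep_processes P Y X"
proof -
  interpret prob_space P by fact
  let ?S = "PiM {0::real..} (\<lambda>_. borel :: real measure)"
  let ?X = "\<lambda>\<omega>. \<lambda>t\<in>{0..}. X t \<omega>" and ?Y = "\<lambda>\<omega>. \<lambda>t\<in>{0..}. Y t \<omega>"
  have ind: "indep_var ?S ?X ?S ?Y" using assms by (simp add: indep_processes_def)
  have rv [measurable]: "?X \<in> measurable P ?S" "?Y \<in> measurable P ?S"
    using indep_var_rv1[OF ind] indep_var_rv2[OF ind] .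
  interpret X: prob_space "distr P ?S ?X" by (rule prob_space_distr) simp
  interpret Y: prob_space "distr P ?S ?Y" by (rule prob_space_distr) simp
  interpret pair_sigma_finite "distr P ?S ?Y" "distr P ?S ?X" ..
  have "distr P ?S ?Y \<Otimes>\<^sub>M distr P ?S ?X =
      distr (distr P ?S ?X \<Otimes>\<^sub>M distr P ?S ?Y) (?S \<Otimes>\<^sub>M ?S) (\<lambda>(x, y). (y, x))"
    by (subst distr_pair_swap) (simp cong: distr_cong)
  also have "distr P ?S ?X \<Otimes>\<^sub>M distr P ?S ?Y = distr P (?S \<Otimes>\<^sub>M ?S) (\<lambda>\<omega>. (?X \<omega>, ?Y \<omega>))"
    using ind unfolding indep_var_distribution_eq by simp
  also have "distr \<dots> (?S \<Otimes>\<^sub>M ?S) (\<lambda>(x, y). (y, x)) = distr P (?S \<Otimes>\<^sub>M ?S) (\<lambda>\<omega>. (?Y \<omega>, ?X \<omega>))"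
    by (subst distr_distr) (auto simp: comp_def)
  finally have "distr P ?S ?Y \<Otimes>\<^sub>M distr P ?S ?X = distr P (?S \<Otimes>\<^sub>M ?S) (\<lambda>\<omega>. (?Y \<omega>, ?X \<omega>))" .
  then show ?thesis unfolding indep_processes_def indep_var_distribution_eq by (intro conjI rv)
qed

section \<open>The inverse of a stable subordinator\<close>

text \<open>
  This and the next formula express \<open>exp (- c x)\<close> and \<open>exp (c x) - 1\<close> as integrals of indicators in
  \<open>x\<close>, which turns exponential moments of the inverse subordinator into integrals of probabilities.
\<close>

lemma nn_integral_exp_tail:
  fixes c x :: real
  assumes "c > 0"
  shows "(\<integral>\<^sup>+h. ennreal (c * exp (- c * h)) * indicator {x..} h \<partial>lborel) = ennreal (exp (- c * x))"
proof -
  have "(\<integral>\<^sup>+h. ennreal (c * exp (- c * h)) * indicator {x..} h \<partial>lborel) = ennreal (0 - (- exp (- c * x)))"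
  proof (rule nn_integral_FTC_atLeast)
    show "((\<lambda>h. - exp (- c * h)) \<longlongrightarrow> 0) at_top" using assms by real_asymp
  qed (use assms in \<open>auto intro!: derivative_eq_intros\<close>)
  then show ?thesis by simp
qed

lemma nn_integral_exp_segment:
  fixes c x :: real
  assumes "c > 0" "x \<ge> 0"
  shows "(\<integral>\<^sup>+r. ennreal (c * exp (c * r)) * indicator {0..x} r \<partial>lborel) = ennreal (exp (c * x) - 1)"
proof -
  have "(\<integral>\<^sup>+r. ennreal (c * exp (c * r)) * indicator {0..x} r \<partial>lborel) = ennreal (exp (c * x) - exp (c * 0))"
    by (rule nn_integral_FTC_Icc) (use assms in \<open>auto intro!: derivative_eq_intros\<close>)
  then show ?thesis by simp
qed

lemma nn_integral_layer:
  assumes "prob_space P" and [measurable]: "X \<in> borel_measurable P" and "\<And>\<omega>. \<omega> \<in> space P \<Longrightarrow> X \<omega> \<ge> 0"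
  shows "(\<integral>\<^sup>+\<omega>. ennreal (X \<omega>) \<partial>P) = (\<integral>\<^sup>+r. emeasure P {\<omega>\<in>space P. r < X \<omega>} * indicator {0..} r \<partial>lborel)"
proof -
  interpret prob_space P by fact
  interpret pair_sigma_finite lborel P ..
  have "(\<integral>\<^sup>+\<omega>. ennreal (X \<omega>) \<partial>P) = (\<integral>\<^sup>+\<omega>. (\<integral>\<^sup>+r. indicator {p\<in>space (borel \<Otimes>\<^sub>M P). 0 \<le> fst p \<and> fst p < X (snd p)} (r, \<omega>) \<partial>lborel) \<partial>P)"
  proof (rule nn_integral_cong)
    fix \<omega> assume "\<omega> \<in> space P"
    then have "(\<integral>\<^sup>+r. indicator {p\<in>space (borel \<Otimes>\<^sub>M P). 0 \<le> fst p \<and> fst p < X (snd p)} (r, \<omega>) \<partial>lborel)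
      = (\<integral>\<^sup>+r. indicator {0..<X \<omega>} r \<partial>lborel)"
      by (intro nn_integral_cong) (auto simp: space_pair_measure split: split_indicator)
    then show "ennreal (X \<omega>) = (\<integral>\<^sup>+r. indicator {p\<in>space (borel \<Otimes>\<^sub>M P). 0 \<le> fst p \<and> fst p < X (snd p)} (r, \<omega>) \<partial>lborel)"
      using assms(3) \<open>\<omega> \<in> space P\<close> by simp
  qed
  also have "\<dots> = (\<integral>\<^sup>+r. (\<integral>\<^sup>+\<omega>. indicator {p\<in>space (borel \<Otimes>\<^sub>M P). 0 \<le> fst p \<and> fst p < X (snd p)} (r, \<omega>) \<partial>P) \<partial>lborel)"
    by (rule Fubini') simp
  also have "\<dots> = (\<integral>\<^sup>+r. emeasure P {\<omega>\<in>space P. r < X \<omega>} * indicator {0..} r \<partial>lborel)"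
  proof (rule nn_integral_cong)
    fix r :: real
    have "(\<integral>\<^sup>+\<omega>. indicator {p\<in>space (borel \<Otimes>\<^sub>M P). 0 \<le> fst p \<and> fst p < X (snd p)} (r, \<omega>) \<partial>P)
      = (\<integral>\<^sup>+\<omega>. indicator {0..} r * indicator {\<omega>\<in>space P. r < X \<omega>} \<omega> \<partial>P)"
      by (intro nn_integral_cong) (auto simp: space_pair_measure split: split_indicator)
    then show "(\<integral>\<^sup>+\<omega>. indicator {p\<in>space (borel \<Otimes>\<^sub>M P). 0 \<le> fst p \<and> fst p < X (snd p)} (r, \<omega>) \<partial>P)
      = emeasure P {\<omega>\<in>space P. r < X \<omega>} * indicator {0..} r"
      by (simp add: nn_integral_cmult mult.commute)
  qed
  finally show ?thesis .
qed

text \<open>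
  Measurability of the inverse is a hypothesis here because it is part of its independence from
  the Poisson process.
\<close>

locale stable_inverse = prob_space P for P :: "'w measure" +
  fixes S :: "real \<Rightarrow> 'w \<Rightarrow> real" and \<beta> rate :: real
  assumes \<beta>: "0 < \<beta>" "\<beta> < 1" and rate: "rate > 0"
    and stable: "stable_subordinator P \<beta> S"
    and inverse_measurable: "\<And>a. a \<ge> 0 \<Longrightarrow> inverse_subordinator S a \<in> borel_measurable P"
begin

abbreviation E :: "real \<Rightarrow> 'w \<Rightarrow> real" where "E \<equiv> inverse_subordinator S"

text \<open>
  Conditionally on \<open>E\<close>, the number of events of the fractional Poisson process up to time \<open>b\<close> is a
  Poisson variable with parameter \<open>rate * E b\<close>. So this is the probability of no event up to time \<open>b\<close>,
  and \<open>mean_count\<close> below is the expected number of events.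
\<close>

definition survival :: "real \<Rightarrow> real" where
  "survival b = expectation (\<lambda>\<omega>. exp (- rate * E b \<omega>))"

definition mean_count :: "real \<Rightarrow> real" where
  "mean_count a = rate * expectation (E a)"

lemma E_nonneg [simp]: "E a \<omega> \<ge> 0"
  by (rule inverse_subordinator_nonneg)

lemma subordinator: "subordinator P S" and levy: "levy_process P S"
  using stable by (auto simp: stable_subordinator_def subordinator_def)

lemma S_measurable [measurable]: "t \<ge> 0 \<Longrightarrow> S t \<in> borel_measurable P"
  using levy unfolding levy_process_def by blast

text \<open>
  Chernoff's bound.
\<close>

lemma prob_S_le:
  assumes "r \<ge> 0" "u \<ge> 0"
  shows "prob {\<omega>\<in>space P. S r \<omega> \<le> a} \<le> exp (u * a - r * u powr \<beta>)"
proof -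
  have [measurable]: "S r \<in> borel_measurable P" using assms by simp
  have int: "integrable P (\<lambda>\<omega>. exp (- u * S r \<omega>))"
    using subordinator_path(4)[OF subordinator _ assms(1)] assms
    by (intro integrable_const_bound[where B = 1]) (auto simp: mult_nonneg_nonneg)
  have "prob {\<omega>\<in>space P. S r \<omega> \<le> a} = expectation (indicator {\<omega>\<in>space P. S r \<omega> \<le> a})"
    by simp
  also have "\<dots> \<le> expectation (\<lambda>\<omega>. exp (u * a) * exp (- u * S r \<omega>))"
  proof (rule integral_mono)
    show "integrable P (indicat_real {\<omega>\<in>space P. S r \<omega> \<le> a})"
      by (intro integrable_const_bound[where B = 1]) (auto split: split_indicator)
    show "indicat_real {\<omega>\<in>space P. S r \<omega> \<le> a} \<omega> \<le> exp (u * a) * exp (- u * S r \<omega>)" for \<omega>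
      using assms by (auto split: split_indicator simp: exp_add[symmetric] intro: mult_left_mono)
  qed (rule integrable_mult_right[OF int])
  also have "\<dots> = exp (u * a) * exp (- r * u powr \<beta>)"
    using stable assms by (simp add: stable_subordinator_def)
  finally show ?thesis by (simp add: exp_add[symmetric])
qed

lemma AE_unbounded: "AE \<omega> in P. \<forall>t. \<exists>r\<ge>0. S r \<omega> > t"
proof -
  have "AE \<omega> in P. \<exists>r\<ge>0. S r \<omega> > real c" for c :: nat
  proof -
    let ?A = "{\<omega>\<in>space P. \<forall>n::nat. S (real n) \<omega> \<le> real c}"
    have "prob ?A \<le> 0"
    proof (rule tendsto_lowerbound)
      show "(\<lambda>n. exp (real c - real n)) \<longlonglongrightarrow> 0" by real_asymp
      show "\<forall>\<^sub>F n in sequentially. prob ?A \<le> exp (real c - real n)"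
      proof (intro always_eventually allI)
        fix n
        have "prob ?A \<le> prob {\<omega>\<in>space P. S (real n) \<omega> \<le> real c}"
          by (intro finite_measure_mono) auto
        also have "\<dots> \<le> exp (real c - real n)" using prob_S_le[of "real n" 1 "real c"] by simp
        finally show "prob ?A \<le> exp (real c - real n)" .
      qed
    qed simp
    then have "AE \<omega> in P. \<omega> \<notin> ?A"
      by (intro AE_not_in null_setsI) (auto simp: emeasure_eq_measure order.antisym)
    with AE_space show ?thesis by eventually_elim (auto simp: not_le intro: of_nat_0_le_iff)
  qed
  then have "AE \<omega> in P. \<forall>c::nat. \<exists>r\<ge>0. S r \<omega> > real c" by (simp add: AE_all_countable)
  then show ?thesis
  proof eventually_elim
    case (elim \<omega>)
    show ?case
    proof
      fix t :: real
      obtain c :: nat where "t \<le> real c" using real_arch_simple by blast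
      with elim show "\<exists>r\<ge>0. S r \<omega> > t" by (meson order.strict_trans1)
    qed
  qed
qed

lemma E_less_imp: "AE \<omega> in P. \<forall>t r. E t \<omega> < r \<longrightarrow> S r \<omega> > t"
  using AE_unbounded AE_space
proof eventually_elim
  case (elim \<omega>)
  show ?case
    using inverse_subordinator_less[of S \<omega>, OF subordinator_path(2)[OF subordinator elim(2)]] elim(1) by blast
qed

lemma AE_E_mono: "AE \<omega> in P. \<forall>a b. a \<le> b \<longrightarrow> E a \<omega> \<le> E b \<omega>"
  using AE_unbounded by eventually_elim (blast intro: inverse_subordinator_mono)

lemma less_E_imp: "r \<ge> 0 \<Longrightarrow> r < E a \<omega> \<Longrightarrow> S r \<omega> \<le> a"
  using inverse_subordinator_le[of r a S \<omega>] by (meson not_le)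

text \<open>
  If \<open>E a\<close> exceeds \<open>r\<close> then \<open>S r\<close> has not passed \<open>a\<close>; integrate the Chernoff bound over \<open>r\<close>.
\<close>

lemma nn_integral_E_le:
  assumes "a \<ge> 0" "u > 0"
  shows "(\<integral>\<^sup>+\<omega>. ennreal (E a \<omega>) \<partial>P) \<le> ennreal (exp (u * a) / u powr \<beta>)"
proof -
  let ?c = "u powr \<beta>"
  note [measurable] = inverse_measurable[OF assms(1)]
  have c: "?c > 0" using assms by simp
  have "(\<integral>\<^sup>+\<omega>. ennreal (E a \<omega>) \<partial>P) = (\<integral>\<^sup>+r. emeasure P {\<omega>\<in>space P. r < E a \<omega>} * indicator {0..} r \<partial>lborel)"
    by (rule nn_integral_layer) (auto simp: inverse_subordinator_nonneg prob_space_axioms)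
  also have "\<dots> \<le> (\<integral>\<^sup>+r. ennreal (exp (u * a) / ?c) * (ennreal (?c * exp (- ?c * r)) * indicator {0..} r) \<partial>lborel)"
  proof (rule nn_integral_mono)
    fix r :: real
    have "emeasure P {\<omega>\<in>space P. r < E a \<omega>} \<le> ennreal (exp (u * a) / ?c) * ennreal (?c * exp (- ?c * r))" if r: "r \<ge> 0"
    proof -
      have [measurable]: "S r \<in> borel_measurable P" using that by simp
      have "prob {\<omega>\<in>space P. r < E a \<omega>} \<le> prob {\<omega>\<in>space P. S r \<omega> \<le> a}"
        using r less_E_imp by (intro finite_measure_mono) auto
      also have "\<dots> \<le> exp (u * a - r * ?c)" using prob_S_le[OF r] assms by simp
      also have "\<dots> = exp (u * a) / ?c * (?c * exp (- ?c * r))"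
        using c by (simp add: exp_diff exp_minus field_simps)
      finally show ?thesis using c by (simp add: emeasure_eq_measure ennreal_mult[symmetric] del: ennreal_mult')
    qed
    then show "emeasure P {\<omega>\<in>space P. r < E a \<omega>} * indicator {0..} r
      \<le> ennreal (exp (u * a) / ?c) * (ennreal (?c * exp (- ?c * r)) * indicator {0..} r)"
      by (auto split: split_indicator)
  qed
  also have "\<dots> = ennreal (exp (u * a) / ?c)"
    using nn_integral_exp_tail[OF c, of 0] by (subst nn_integral_cmult) auto
  finally show ?thesis .
qed

lemma integrable_E:
  assumes "a \<ge> 0" shows "integrable P (E a)"
  using nn_integral_E_le[OF assms, of 1] inverse_measurable[OF assms]
  by (intro integrableI_nonneg) (auto simp: inverse_subordinator_nonneg intro: le_less_trans)

text \<open>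
  The choice \<open>u = 1 / a\<close> in the preceding bound reproduces the true order \<open>a\<^sup>\<beta>\<close>. Near \<open>0\<close> this
  bounds the probability of an early event; for large \<open>a\<close> it makes \<open>mean_count\<close> sublinear.
\<close>

lemma mean_count_le:
  assumes "a > 0" shows "mean_count a \<le> rate * exp 1 * a powr \<beta>"
proof -
  have "ennreal (expectation (E a)) = (\<integral>\<^sup>+\<omega>. ennreal (E a \<omega>) \<partial>P)"
    using integrable_E assms by (intro nn_integral_eq_integral[symmetric]) (auto simp: inverse_subordinator_nonneg)
  also have "\<dots> \<le> ennreal (exp (1 / a * a) / (1 / a) powr \<beta>)"
    using assms by (intro nn_integral_E_le) auto
  also have "exp (1 / a * a) / (1 / a) powr \<beta> = exp 1 * a powr \<beta>"
    using assms by (simp add: powr_divide)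
  finally have "expectation (E a) \<le> exp 1 * a powr \<beta>"
    by (subst (asm) ennreal_le_iff) auto
  then show ?thesis using rate by (simp add: mean_count_def)
qed

lemma integrable_exp_E:
  assumes "b \<ge> 0" shows "integrable P (\<lambda>\<omega>. exp (- rate * E b \<omega>))"
  using inverse_measurable[OF assms] rate
  by (intro integrable_const_bound[where B = 1]) auto

lemma survival_bounds:
  assumes "b \<ge> 0" shows "0 \<le> survival b" "survival b \<le> 1"
proof -
  show "0 \<le> survival b" by (simp add: survival_def)
  show "survival b \<le> 1" unfolding survival_def
    using rate by (intro integral_le_const integrable_exp_E assms) auto
qed

lemma survival_antimono:
  assumes "0 \<le> a" "a \<le> b" shows "survival b \<le> survival a"
  unfolding survival_def
proof (rule integral_mono_AE)
  show "AE \<omega> in P. exp (- rate * E b \<omega>) \<le> exp (- rate * E a \<omega>)"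
    using AE_E_mono by eventually_elim (use assms rate in auto)
qed (rule integrable_exp_E; use assms in simp)+

lemma mean_count_mono:
  assumes "0 \<le> a" "a \<le> b" shows "mean_count a \<le> mean_count b"
proof -
  have "expectation (E a) \<le> expectation (E b)"
    by (rule integral_mono_AE) (use assms AE_E_mono in \<open>auto intro!: integrable_E\<close>)
  then show ?thesis using rate by (simp add: mean_count_def)
qed

lemma mean_count_nonneg: "mean_count a \<ge> 0"
  using rate by (auto simp: mean_count_def intro!: integral_nonneg_AE)

text \<open>
  Jensen's inequality, from the tangent to \<open>exp (- x)\<close> at the mean.
\<close>

lemma survival_ge_exp_mean:
  assumes "b \<ge> 0" shows "survival b \<ge> exp (- mean_count b)"
proof -
  let ?m = "mean_count b"
  have tangent: "exp (- ?m) * (1 - (x - ?m)) \<le> exp (- x)" for x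
  proof -
    have "1 - (x - ?m) \<le> exp (?m - x)"
      using exp_ge_add_one_self[of "?m - x"] by linarith
    then have "exp (- ?m) * (1 - (x - ?m)) \<le> exp (- ?m) * exp (?m - x)" by (rule mult_left_mono) simp
    then show ?thesis by (simp add: exp_add[symmetric])
  qed
  have "expectation (\<lambda>\<omega>. exp (- ?m) * (1 - (rate * E b \<omega> - ?m))) \<le> survival b"
    unfolding survival_def
  proof (rule integral_mono)
    show "integrable P (\<lambda>\<omega>. exp (- ?m) * (1 - (rate * E b \<omega> - ?m)))"
      using integrable_E[OF assms] by simp
    show "exp (- ?m) * (1 - (rate * E b \<omega> - ?m)) \<le> exp (- rate * E b \<omega>)" for \<omega>
      using tangent[of "rate * E b \<omega>"] by simp
  qed (rule integrable_exp_E[OF assms])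
  also have "expectation (\<lambda>\<omega>. exp (- ?m) * (1 - (rate * E b \<omega> - ?m))) = exp (- ?m)"
    using integrable_E[OF assms] by (simp add: prob_space mean_count_def)
  finally show ?thesis .
qed

end

section \<open>Silent stretches of the fractional Poisson process\<close>

text \<open>
  The strict and the non-strict version differ by a single \<open>h\<close> for each \<open>\<omega>\<close>. Both are needed: the event
  \<open>E b < h\<close> implies \<open>S h > b\<close> almost surely, but \<open>S h > b\<close> only gives back \<open>E b \<le> h\<close>.
\<close>

lemma (in prob_space) nn_integral_exp_layer:
  fixes c :: real
  assumes c: "c > 0" and [measurable]: "X \<in> borel_measurable M" "A \<in> events"
  shows "(\<integral>\<^sup>+\<omega>. ennreal (exp (- c * X \<omega>)) * indicator A \<omega> \<partial>M)
      = (\<integral>\<^sup>+h. ennreal (c * exp (- c * h)) * emeasure M {\<omega>\<in>A. X \<omega> \<le> h} \<partial>lborel)"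
    and "(\<integral>\<^sup>+\<omega>. ennreal (exp (- c * X \<omega>)) * indicator A \<omega> \<partial>M)
      = (\<integral>\<^sup>+h. ennreal (c * exp (- c * h)) * emeasure M {\<omega>\<in>A. X \<omega> < h} \<partial>lborel)"
proof -
  interpret pair_sigma_finite lborel M ..
  have [measurable]: "Measurable.pred (borel \<Otimes>\<^sub>M M) (\<lambda>p. snd p \<in> A)"
    by simp
  have swap: "(\<integral>\<^sup>+\<omega>. (\<integral>\<^sup>+h. ennreal (c * exp (- c * h)) * indicator {p\<in>space (borel \<Otimes>\<^sub>M M). snd p \<in> A \<and> Q (X (snd p)) (fst p)} (h, \<omega>) \<partial>lborel) \<partial>M)
     = (\<integral>\<^sup>+h. ennreal (c * exp (- c * h)) * emeasure M {\<omega>\<in>A. Q (X \<omega>) h} \<partial>lborel)"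
    if [measurable]: "Measurable.pred (borel \<Otimes>\<^sub>M M) (\<lambda>p. Q (X (snd p)) (fst p))" for Q
  proof -
    have "(\<integral>\<^sup>+\<omega>. (\<integral>\<^sup>+h. ennreal (c * exp (- c * h)) * indicator {p\<in>space (borel \<Otimes>\<^sub>M M). snd p \<in> A \<and> Q (X (snd p)) (fst p)} (h, \<omega>) \<partial>lborel) \<partial>M)
      = (\<integral>\<^sup>+h. (\<integral>\<^sup>+\<omega>. ennreal (c * exp (- c * h)) * indicator {p\<in>space (borel \<Otimes>\<^sub>M M). snd p \<in> A \<and> Q (X (snd p)) (fst p)} (h, \<omega>) \<partial>M) \<partial>lborel)"
      by (rule Fubini') simp
    also have "\<dots> = (\<integral>\<^sup>+h. ennreal (c * exp (- c * h)) * emeasure M {\<omega>\<in>A. Q (X \<omega>) h} \<partial>lborel)"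
    proof (rule nn_integral_cong)
      fix h :: real
      have "(\<lambda>\<omega>. (h, \<omega>)) \<in> measurable M (borel \<Otimes>\<^sub>M M)" by simp
      from measurable_compose[OF this that] have [measurable]: "Measurable.pred M (\<lambda>\<omega>. Q (X \<omega>) h)" by simp
      have eq: "{\<omega>\<in>A. Q (X \<omega>) h} = {\<omega>\<in>space M. \<omega> \<in> A \<and> Q (X \<omega>) h}"
        using sets.sets_into_space[OF assms(3)] by auto
      have "(\<integral>\<^sup>+\<omega>. ennreal (c * exp (- c * h)) * indicator {p\<in>space (borel \<Otimes>\<^sub>M M). snd p \<in> A \<and> Q (X (snd p)) (fst p)} (h, \<omega>) \<partial>M)
        = (\<integral>\<^sup>+\<omega>. ennreal (c * exp (- c * h)) * indicator {\<omega>\<in>A. Q (X \<omega>) h} \<omega> \<partial>M)"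
        unfolding eq by (intro nn_integral_cong) (auto simp: space_pair_measure split: split_indicator)
      also have "\<dots> = ennreal (c * exp (- c * h)) * emeasure M {\<omega>\<in>A. Q (X \<omega>) h}"
        unfolding eq by (subst nn_integral_cmult) auto
      finally show "(\<integral>\<^sup>+\<omega>. ennreal (c * exp (- c * h)) * indicator {p\<in>space (borel \<Otimes>\<^sub>M M). snd p \<in> A \<and> Q (X (snd p)) (fst p)} (h, \<omega>) \<partial>M)
        = ennreal (c * exp (- c * h)) * emeasure M {\<omega>\<in>A. Q (X \<omega>) h}" .
    qed
    finally show ?thesis .
  qed
  have le: "(\<integral>\<^sup>+h. ennreal (c * exp (- c * h)) * indicator {p\<in>space (borel \<Otimes>\<^sub>M M). snd p \<in> A \<and> X (snd p) \<le> fst p} (h, \<omega>) \<partial>lborel)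
      = ennreal (exp (- c * X \<omega>)) * indicator A \<omega>" if "\<omega> \<in> space M" for \<omega>
  proof (cases "\<omega> \<in> A")
    case True
    then show ?thesis using that
      by (subst nn_integral_exp_tail[OF c, symmetric])
         (auto intro!: nn_integral_cong simp: space_pair_measure split: split_indicator)
  qed simp
  have less: "(\<integral>\<^sup>+h. ennreal (c * exp (- c * h)) * indicator {p\<in>space (borel \<Otimes>\<^sub>M M). snd p \<in> A \<and> X (snd p) < fst p} (h, \<omega>) \<partial>lborel)
      = ennreal (exp (- c * X \<omega>)) * indicator A \<omega>" if "\<omega> \<in> space M" for \<omega>
    unfolding le[OF that, symmetric]
    using AE_lborel_singleton[of "X \<omega>"]
    by (intro nn_integral_cong_AE) (auto elim!: eventually_mono split: split_indicator)
  show "(\<integral>\<^sup>+\<omega>. ennreal (exp (- c * X \<omega>)) * indicator A \<omega> \<partial>M)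
      = (\<integral>\<^sup>+h. ennreal (c * exp (- c * h)) * emeasure M {\<omega>\<in>A. X \<omega> \<le> h} \<partial>lborel)"
    by (subst swap[symmetric]) (simp, rule nn_integral_cong, rule le[symmetric])
  show "(\<integral>\<^sup>+\<omega>. ennreal (exp (- c * X \<omega>)) * indicator A \<omega> \<partial>M)
      = (\<integral>\<^sup>+h. ennreal (c * exp (- c * h)) * emeasure M {\<omega>\<in>A. X \<omega> < h} \<partial>lborel)"
    by (subst swap[symmetric]) (simp, rule nn_integral_cong, rule less[symmetric])
qed

context stable_inverse
begin

lemma survival_nn: "b \<ge> 0 \<Longrightarrow> (\<integral>\<^sup>+\<omega>. ennreal (exp (- rate * E b \<omega>)) \<partial>P) = ennreal (survival b)"
  unfolding survival_def by (rule nn_integral_eq_integral[OF integrable_exp_E]) auto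

text \<open>
  The Markov property of \<open>S\<close> at the fixed time \<open>r\<close>, in the form of independence of \<open>S r\<close> and
  \<open>S (r + h) - S r\<close>: if \<open>S r \<le> a\<close> and the increment exceeds \<open>b\<close>, then \<open>E a \<ge> r\<close> and, since \<open>S r \<ge> 0\<close>,
  \<open>E b \<le> r + h\<close>. For each \<open>h\<close> the restarted inverse enters through a
  single increment of \<open>S\<close>.
\<close>

lemma prob_restart:
  assumes "0 \<le> a" "0 \<le> b" "0 \<le> r" "0 \<le> h"
  shows "prob {\<omega>\<in>space P. r < E a \<omega>} * prob {\<omega>\<in>space P. E b \<omega> < h}
    \<le> prob {\<omega>\<in>space P. r \<le> E a \<omega> \<and> E b \<omega> \<le> r + h}"
proof -
  note [measurable] = inverse_measurable[OF assms(1)] inverse_measurable[OF assms(2)]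
  have [measurable]: "S r \<in> borel_measurable P" "S h \<in> borel_measurable P" "S (r + h) \<in> borel_measurable P"
    using assms by simp_all
  have "prob {\<omega>\<in>space P. r < E a \<omega>} \<le> prob {\<omega>\<in>space P. S r \<omega> \<in> {..a}}"
    using less_E_imp assms by (intro finite_measure_mono) auto
  moreover have "prob {\<omega>\<in>space P. E b \<omega> < h} \<le> prob {\<omega>\<in>space P. S h \<omega> \<in> {b<..}}"
    by (rule finite_measure_mono_AE) (use E_less_imp in \<open>auto elim!: eventually_mono\<close>)
  ultimately have "prob {\<omega>\<in>space P. r < E a \<omega>} * prob {\<omega>\<in>space P. E b \<omega> < h}
      \<le> prob {\<omega>\<in>space P. S r \<omega> \<in> {..a}} * prob {\<omega>\<in>space P. S h \<omega> \<in> {b<..}}"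
    by (intro mult_mono) auto
  also have "\<dots> = prob {\<omega>\<in>space P. S r \<omega> \<in> {..a} \<and> S (r + h) \<omega> - S r \<omega> \<in> {b<..}}"
    using levy_process_prob_increment[OF prob_space_axioms levy assms(3,4), of "{..a}" "{b<..}"] by simp
  also have "\<dots> \<le> prob {\<omega>\<in>space P. r \<le> E a \<omega> \<and> E b \<omega> \<le> r + h}"
  proof (rule finite_measure_mono_AE)
    show "AE \<omega> in P. \<omega> \<in> {\<omega>\<in>space P. S r \<omega> \<in> {..a} \<and> S (r + h) \<omega> - S r \<omega> \<in> {b<..}} \<longrightarrow>
        \<omega> \<in> {\<omega>\<in>space P. r \<le> E a \<omega> \<and> E b \<omega> \<le> r + h}"
      using E_less_imp AE_space
    proof eventually_elim
      case (elim \<omega>)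
      show ?case
      proof
        assume A: "\<omega> \<in> {\<omega>\<in>space P. S r \<omega> \<in> {..a} \<and> S (r + h) \<omega> - S r \<omega> \<in> {b<..}}"
        have "S r \<omega> \<ge> 0" using subordinator_path(4)[OF subordinator elim(2) assms(3)] .
        then have "b < S (r + h) \<omega>" using A by auto
        then have "E b \<omega> \<le> r + h" using assms by (intro inverse_subordinator_le) auto
        moreover have "\<not> E a \<omega> < r"
        proof
          assume "E a \<omega> < r"
          then have "a < S r \<omega>" using elim(1) by blast
          then show False using A by auto
        qed
        ultimately show "\<omega> \<in> {\<omega>\<in>space P. r \<le> E a \<omega> \<and> E b \<omega> \<le> r + h}" using elim(2) by auto
      qed
    qed
  qed simp
  finally show ?thesis .
qed

text \<open>
  The preceding inequality integrated against the density \<open>rate * exp (- rate * h)\<close> of the waiting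
  time, shifted by \<open>r\<close>.
\<close>

lemma survival_restart:
  assumes "0 \<le> a" "0 \<le> b" "0 \<le> r"
  shows "ennreal (exp (- rate * r)) * (emeasure P {\<omega>\<in>space P. r < E a \<omega>} * ennreal (survival b))
    \<le> (\<integral>\<^sup>+\<omega>. ennreal (exp (- rate * E b \<omega>)) * indicator {\<omega>\<in>space P. r \<le> E a \<omega>} \<omega> \<partial>P)"
proof -
  note [measurable] = inverse_measurable[OF assms(1)] inverse_measurable[OF assms(2)]
  interpret lP: pair_sigma_finite lborel P ..
  let ?c = rate
  have m1 [measurable]: "(\<lambda>h. emeasure P {\<omega>\<in>space P. E b \<omega> < h}) \<in> borel_measurable borel"
    by measurable
  have m2 [measurable]: "(\<lambda>h. emeasure P {\<omega>\<in>space P. r \<le> E a \<omega> \<and> E b \<omega> \<le> h}) \<in> borel_measurable borel"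
    by measurable
  have L: "ennreal (survival b) = (\<integral>\<^sup>+h. ennreal (?c * exp (- ?c * h)) * emeasure P {\<omega>\<in>space P. E b \<omega> < h} \<partial>lborel)"
  proof -
    have "ennreal (survival b) = (\<integral>\<^sup>+\<omega>. ennreal (exp (- ?c * E b \<omega>)) * indicator (space P) \<omega> \<partial>P)"
      unfolding survival_nn[OF assms(2), symmetric] by (intro nn_integral_cong) auto
    also have "\<dots> = (\<integral>\<^sup>+h. ennreal (?c * exp (- ?c * h)) * emeasure P {\<omega>\<in>space P. E b \<omega> < h} \<partial>lborel)"
      by (rule nn_integral_exp_layer(2)[OF rate]) auto
    finally show ?thesis .
  qed
  have "ennreal (exp (- ?c * r)) * (emeasure P {\<omega>\<in>space P. r < E a \<omega>} * ennreal (survival b))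
     = (\<integral>\<^sup>+h. ennreal (exp (- ?c * r)) * (emeasure P {\<omega>\<in>space P. r < E a \<omega>} * (ennreal (?c * exp (- ?c * h)) * emeasure P {\<omega>\<in>space P. E b \<omega> < h})) \<partial>lborel)"
    unfolding L by (simp add: nn_integral_cmult)
  also have "\<dots> \<le> (\<integral>\<^sup>+h. ennreal (?c * exp (- ?c * (r + 1 * h))) * emeasure P {\<omega>\<in>space P. r \<le> E a \<omega> \<and> E b \<omega> \<le> r + 1 * h} \<partial>lborel)"
  proof (rule nn_integral_mono)
    fix h :: real
    show "ennreal (exp (- ?c * r)) * (emeasure P {\<omega>\<in>space P. r < E a \<omega>} * (ennreal (?c * exp (- ?c * h)) * emeasure P {\<omega>\<in>space P. E b \<omega> < h}))
       \<le> ennreal (?c * exp (- ?c * (r + 1 * h))) * emeasure P {\<omega>\<in>space P. r \<le> E a \<omega> \<and> E b \<omega> \<le> r + 1 * h}"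
    proof (cases "h \<ge> 0")
      case True
      have "exp (- ?c * r) * (prob {\<omega>\<in>space P. r < E a \<omega>} * (?c * exp (- ?c * h) * prob {\<omega>\<in>space P. E b \<omega> < h}))
          = ?c * exp (- ?c * (r + h)) * (prob {\<omega>\<in>space P. r < E a \<omega>} * prob {\<omega>\<in>space P. E b \<omega> < h})"
      proof -
        have "exp (- ?c * (r + h)) = exp (- ?c * r) * exp (- ?c * h)"
          by (simp add: exp_add[symmetric] algebra_simps)
        then show ?thesis by (simp only: mult_ac)
      qed
      also have "\<dots> \<le> ?c * exp (- ?c * (r + h)) * prob {\<omega>\<in>space P. r \<le> E a \<omega> \<and> E b \<omega> \<le> r + h}"
        using prob_restart[OF assms True] rate by (intro mult_left_mono) auto
      finally show ?thesis
        using rate by (simp add: emeasure_eq_measure ennreal_mult[symmetric])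
    next
      case False
      then have "{\<omega>\<in>space P. E b \<omega> < h} = {}" using order.strict_trans1[OF E_nonneg, of b _ h] by auto
      then show ?thesis by (simp only: emeasure_empty mult_zero_right zero_le)
    qed
  qed
  also have "\<dots> = (\<integral>\<^sup>+h. ennreal (?c * exp (- ?c * h)) * emeasure P {\<omega>\<in>space P. r \<le> E a \<omega> \<and> E b \<omega> \<le> h} \<partial>lborel)"
    by (subst nn_integral_real_affine[where c = 1 and t = r]) simp_all
  also have "\<dots> = (\<integral>\<^sup>+h. ennreal (?c * exp (- ?c * h)) * emeasure P {\<omega>\<in>{\<omega>\<in>space P. r \<le> E a \<omega>}. E b \<omega> \<le> h} \<partial>lborel)"
    by simp
  also have "\<dots> = (\<integral>\<^sup>+\<omega>. ennreal (exp (- ?c * E b \<omega>)) * indicator {\<omega>\<in>space P. r \<le> E a \<omega>} \<omega> \<partial>P)"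
    by (rule nn_integral_exp_layer(1)[OF rate, symmetric]) auto
  finally show ?thesis .
qed

text \<open>
  Almost surely \<open>E a \<le> E b\<close>, so after subtraction of \<open>survival b\<close> the task is to bound from below
  \<open>E[exp (- rate * E b) * (exp (rate * E a) - 1)]\<close>. Writing the second factor
  as the integral of \<open>rate * exp (rate * r)\<close> over \<open>0 \<le> r \<le> E a\<close> and applying \<open>survival_restart\<close> for
  each \<open>r\<close>, the exponentials cancel and \<open>rate * P(E a > r)\<close> remains, whose integral is the mean.
  
  The expectation in the claim is the probability that no event occurs in \<open>(a, b]\<close>. The additional term
  \<open>mean_count a * survival b\<close> accounts for paths with events before \<open>a\<close>.
\<close>

lemma silent_stretch_lower_bound:
  assumes "0 \<le> a" "a \<le> b"
  shows "(1 + mean_count a) * survival b \<le> expectation (\<lambda>\<omega>. exp (- rate * \<bar>E b \<omega> - E a \<omega>\<bar>))"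
proof -
  let ?c = rate
  have b: "0 \<le> b" using assms by simp
  note [measurable] = inverse_measurable[OF assms(1)] inverse_measurable[OF b]
  interpret pair_sigma_finite lborel P ..
  have meas_tail [measurable]: "(\<lambda>r. emeasure P {\<omega>\<in>space P. r < E a \<omega>}) \<in> borel_measurable borel"
    by measurable
  have int: "integrable P (\<lambda>\<omega>. exp (- ?c * \<bar>E b \<omega> - E a \<omega>\<bar>))"
    using rate by (intro integrable_const_bound[where B = 1]) auto
  have E_int: "(\<integral>\<^sup>+\<omega>. ennreal (E a \<omega>) \<partial>P) = ennreal (expectation (E a))"
    by (rule nn_integral_eq_integral) (auto intro: integrable_E assms)
  have "ennreal (mean_count a * survival b) = ennreal ?c * ((\<integral>\<^sup>+\<omega>. ennreal (E a \<omega>) \<partial>P) * ennreal (survival b))"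
    unfolding E_int mean_count_def using rate survival_bounds[OF b]
    by (simp add: ennreal_mult'[symmetric] mult.assoc integral_nonneg_AE)
  also have "(\<integral>\<^sup>+\<omega>. ennreal (E a \<omega>) \<partial>P) = (\<integral>\<^sup>+r. emeasure P {\<omega>\<in>space P. r < E a \<omega>} * indicator {0..} r \<partial>lborel)"
    by (rule nn_integral_layer) (auto simp: prob_space_axioms)
  also have "ennreal ?c * (\<dots> * ennreal (survival b)) =
      (\<integral>\<^sup>+r. ennreal ?c * (emeasure P {\<omega>\<in>space P. r < E a \<omega>} * indicator {0..} r * ennreal (survival b)) \<partial>lborel)"
    by (simp add: nn_integral_cmult nn_integral_multc)
  also have "\<dots> \<le> (\<integral>\<^sup>+r. (\<integral>\<^sup>+\<omega>. ennreal (exp (- ?c * E b \<omega>)) * (ennreal (?c * exp (?c * r)) * indicator {p\<in>space (borel \<Otimes>\<^sub>M P). 0 \<le> fst p \<and> fst p \<le> E a (snd p)} (r, \<omega>)) \<partial>P) \<partial>lborel)"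
  proof (rule nn_integral_mono)
    fix r :: real
    show "ennreal ?c * (emeasure P {\<omega>\<in>space P. r < E a \<omega>} * indicator {0..} r * ennreal (survival b))
      \<le> (\<integral>\<^sup>+\<omega>. ennreal (exp (- ?c * E b \<omega>)) * (ennreal (?c * exp (?c * r)) * indicator {p\<in>space (borel \<Otimes>\<^sub>M P). 0 \<le> fst p \<and> fst p \<le> E a (snd p)} (r, \<omega>)) \<partial>P)"
    proof (cases "r \<ge> 0")
      case True
      have "ennreal ?c * (emeasure P {\<omega>\<in>space P. r < E a \<omega>} * ennreal (survival b))
         = ennreal (?c * exp (?c * r)) * (ennreal (exp (- ?c * r)) * (emeasure P {\<omega>\<in>space P. r < E a \<omega>} * ennreal (survival b)))"
      proof -
        have "ennreal ?c = ennreal (?c * exp (?c * r)) * ennreal (exp (- ?c * r))"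
          using rate by (simp add: ennreal_mult[symmetric] exp_minus)
        then show ?thesis by (simp add: mult.assoc)
      qed
      also have "\<dots> \<le> ennreal (?c * exp (?c * r)) * (\<integral>\<^sup>+\<omega>. ennreal (exp (- rate * E b \<omega>)) * indicator {\<omega>\<in>space P. r \<le> E a \<omega>} \<omega> \<partial>P)"
        by (intro mult_left_mono survival_restart assms b True) simp
      also have "\<dots> = (\<integral>\<^sup>+\<omega>. ennreal (?c * exp (?c * r)) * (ennreal (exp (- rate * E b \<omega>)) * indicator {\<omega>\<in>space P. r \<le> E a \<omega>} \<omega>) \<partial>P)"
        by (rule nn_integral_cmult[symmetric]) simp
      also have "\<dots> = (\<integral>\<^sup>+\<omega>. ennreal (exp (- ?c * E b \<omega>)) * (ennreal (?c * exp (?c * r)) * indicator {p\<in>space (borel \<Otimes>\<^sub>M P). 0 \<le> fst p \<and> fst p \<le> E a (snd p)} (r, \<omega>)) \<partial>P)"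
        using True by (intro nn_integral_cong) (auto simp: space_pair_measure mult.commute split: split_indicator)
      finally show ?thesis using True by simp
    qed simp
  qed
  also have "\<dots> = (\<integral>\<^sup>+\<omega>. (\<integral>\<^sup>+r. ennreal (exp (- ?c * E b \<omega>)) * (ennreal (?c * exp (?c * r)) * indicator {p\<in>space (borel \<Otimes>\<^sub>M P). 0 \<le> fst p \<and> fst p \<le> E a (snd p)} (r, \<omega>)) \<partial>lborel) \<partial>P)"
    by (rule Fubini'[symmetric]) simp
  also have "\<dots> = (\<integral>\<^sup>+\<omega>. ennreal (exp (- ?c * E b \<omega>)) * ennreal (exp (?c * E a \<omega>) - 1) \<partial>P)"
  proof (rule nn_integral_cong)
    fix \<omega> assume "\<omega> \<in> space P"
    then have "(\<integral>\<^sup>+r. ennreal (exp (- ?c * E b \<omega>)) * (ennreal (?c * exp (?c * r)) * indicator {p\<in>space (borel \<Otimes>\<^sub>M P). 0 \<le> fst p \<and> fst p \<le> E a (snd p)} (r, \<omega>)) \<partial>lborel)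
      = (\<integral>\<^sup>+r. ennreal (exp (- ?c * E b \<omega>)) * (ennreal (?c * exp (?c * r)) * indicator {0..E a \<omega>} r) \<partial>lborel)"
      by (intro nn_integral_cong) (auto simp: space_pair_measure split: split_indicator)
    also have "\<dots> = ennreal (exp (- ?c * E b \<omega>)) * ennreal (exp (?c * E a \<omega>) - 1)"
      using nn_integral_exp_segment[OF rate E_nonneg] by (subst nn_integral_cmult) auto
    finally show "(\<integral>\<^sup>+r. ennreal (exp (- ?c * E b \<omega>)) * (ennreal (?c * exp (?c * r)) * indicator {p\<in>space (borel \<Otimes>\<^sub>M P). 0 \<le> fst p \<and> fst p \<le> E a (snd p)} (r, \<omega>)) \<partial>lborel)
      = ennreal (exp (- ?c * E b \<omega>)) * ennreal (exp (?c * E a \<omega>) - 1)" .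
  qed
  also have "\<dots> = (\<integral>\<^sup>+\<omega>. ennreal (exp (- ?c * \<bar>E b \<omega> - E a \<omega>\<bar>) - exp (- ?c * E b \<omega>)) \<partial>P)"
  proof (rule nn_integral_cong_AE)
    show "AE \<omega> in P. ennreal (exp (- ?c * E b \<omega>)) * ennreal (exp (?c * E a \<omega>) - 1)
        = ennreal (exp (- ?c * \<bar>E b \<omega> - E a \<omega>\<bar>) - exp (- ?c * E b \<omega>))"
      using AE_E_mono
    proof eventually_elim
      case (elim \<omega>)
      then have "E a \<omega> \<le> E b \<omega>" using assms by blast
      then have "exp (- ?c * \<bar>E b \<omega> - E a \<omega>\<bar>) - exp (- ?c * E b \<omega>) = exp (- ?c * E b \<omega>) * (exp (?c * E a \<omega>) - 1)"
        by (simp add: right_diff_distrib exp_add[symmetric] algebra_simps)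
      then show ?case using rate by (simp add: ennreal_mult')
    qed
  qed
  also have "\<dots> = ennreal (expectation (\<lambda>\<omega>. exp (- ?c * \<bar>E b \<omega> - E a \<omega>\<bar>) - exp (- ?c * E b \<omega>)))"
  proof (rule nn_integral_eq_integral)
    show "AE \<omega> in P. 0 \<le> exp (- ?c * \<bar>E b \<omega> - E a \<omega>\<bar>) - exp (- ?c * E b \<omega>)"
      using AE_E_mono
    proof eventually_elim
      case (elim \<omega>)
      then have "E a \<omega> \<le> E b \<omega>" using assms by blast
      then have "\<bar>E b \<omega> - E a \<omega>\<bar> \<le> E b \<omega>" by simp
      then show ?case using rate by simp
    qed
  qed (intro Bochner_Integration.integrable_diff int integrable_exp_E b)
  also have "expectation (\<lambda>\<omega>. exp (- ?c * \<bar>E b \<omega> - E a \<omega>\<bar>) - exp (- ?c * E b \<omega>)) =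
      expectation (\<lambda>\<omega>. exp (- ?c * \<bar>E b \<omega> - E a \<omega>\<bar>)) - survival b"
    unfolding survival_def by (intro Bochner_Integration.integral_diff int integrable_exp_E b)
  finally have *: "ennreal (mean_count a * survival b) \<le> ennreal (expectation (\<lambda>\<omega>. exp (- ?c * \<bar>E b \<omega> - E a \<omega>\<bar>)) - survival b)" .
  have "survival b \<le> expectation (\<lambda>\<omega>. exp (- ?c * \<bar>E b \<omega> - E a \<omega>\<bar>))"
    unfolding survival_def
  proof (rule integral_mono_AE)
    show "AE \<omega> in P. exp (- ?c * E b \<omega>) \<le> exp (- ?c * \<bar>E b \<omega> - E a \<omega>\<bar>)"
      using AE_E_mono
    proof eventually_elim
      case (elim \<omega>)
      then have "E a \<omega> \<le> E b \<omega>" using assms by blast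
      then have "\<bar>E b \<omega> - E a \<omega>\<bar> \<le> E b \<omega>" by simp
      then show ?case using rate by simp
    qed
  qed (intro int integrable_exp_E b)+
  with * have "mean_count a * survival b \<le> expectation (\<lambda>\<omega>. exp (- ?c * \<bar>E b \<omega> - E a \<omega>\<bar>)) - survival b"
    by (subst (asm) ennreal_le_iff) auto
  then show ?thesis by (simp add: algebra_simps)
qed

text \<open>
  The amount by which the mean number of events of the fractional Poisson process up to time \<open>1\<close> exceeds
  the probability of at least one event.
\<close>

definition jensen_gap :: real where
  "jensen_gap = mean_count 1 - (1 - survival 1)"

lemma mean_count_ge:
  assumes "0 \<le> a" shows "1 - survival a \<le> mean_count a"
  using survival_ge_exp_mean[OF assms] exp_ge_add_one_self[of "- mean_count a"] by simp

text \<open>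
  The function \<open>x - 1 + exp (- x)\<close> is increasing on the nonnegative reals and \<open>E\<close> is increasing in time.
\<close>

lemma mean_count_ge_gap:
  assumes "1 \<le> a" shows "1 - survival a + jensen_gap \<le> mean_count a"
proof -
  have conv: "x - 1 + exp (- x) \<le> y - 1 + exp (- y)" if "0 \<le> x" "x \<le> y" for x y :: real
  proof -
    have "exp (- x) * (1 - (y - x)) \<le> exp (- x) * exp (- (y - x))"
      using exp_ge_add_one_self[of "- (y - x)"] by (intro mult_left_mono exp_ge_zero) linarith
    then have "exp (- x) - exp (- x) * (y - x) \<le> exp (- y)"
      by (simp add: right_diff_distrib exp_add[symmetric])
    moreover have "exp (- x) * (y - x) \<le> 1 * (y - x)"
      using that by (intro mult_right_mono) auto
    ultimately show ?thesis by simp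
  qed
  let ?f = "\<lambda>a \<omega>. rate * E a \<omega> - 1 + exp (- rate * E a \<omega>)"
  have f: "integrable P (?f a)" "expectation (?f a) = mean_count a - (1 - survival a)" if "a \<ge> 0" for a
    using integrable_E[OF that] integrable_exp_E[OF that]
    by (simp_all add: mean_count_def survival_def prob_space)
  have "expectation (?f 1) \<le> expectation (?f a)"
  proof (rule integral_mono_AE)
    show "AE \<omega> in P. ?f 1 \<omega> \<le> ?f a \<omega>"
      using AE_E_mono
    proof eventually_elim
      case (elim \<omega>)
      then have "E 1 \<omega> \<le> E a \<omega>" using assms by blast
      then show ?case using conv[of "rate * E 1 \<omega>" "rate * E a \<omega>"] rate by simp
    qed
  qed (use f assms in auto)
  then show ?thesis using f[of 1] f[of a] assms by (simp add: jensen_gap_def)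
qed

text \<open>
  Otherwise \<open>E 1 = 0\<close> almost surely, hence \<open>S (1/2) > 1\<close> almost surely, which contradicts the Laplace
  transform of \<open>S (1/2)\<close> at \<open>1\<close>.
\<close>

lemma jensen_gap_pos: "jensen_gap > 0"
proof (rule ccontr)
  assume neg: "\<not> jensen_gap > 0"
  let ?f = "\<lambda>\<omega>. rate * E 1 \<omega> - 1 + exp (- rate * E 1 \<omega>)"
  have strict: "y - 1 + exp (- y) > 0" if "y > 0" for y :: real
    using exp_minus_greater[of y] that by simp
  have f: "integrable P ?f" "expectation ?f = jensen_gap"
    using integrable_E[of 1] integrable_exp_E[of 1]
    by (simp_all add: mean_count_def survival_def prob_space jensen_gap_def)
  have f0: "?f \<omega> \<ge> 0" for \<omega>
    using exp_ge_add_one_self[of "- (rate * E 1 \<omega>)"] by simp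
  have "expectation ?f \<ge> 0" using f0 by (intro integral_nonneg_AE) auto
  then have "expectation ?f = 0" using neg f by simp
  then have "AE \<omega> in P. ?f \<omega> = 0"
    using f f0 by (subst (asm) integral_nonneg_eq_0_iff_AE) auto
  then have E0: "AE \<omega> in P. \<not> S (1/2) \<omega> \<le> 1"
    using E_less_imp
  proof eventually_elim
    case (elim \<omega>)
    have "\<not> E 1 \<omega> > 0" using strict[of "rate * E 1 \<omega>"] rate elim(1) by auto
    then have "E 1 \<omega> < 1/2" by simp
    then have "S (1/2) \<omega> > 1" using elim(2) by blast
    then show ?case by simp
  qed
  have [measurable]: "S (1/2) \<in> borel_measurable P" by simp
  have "expectation (\<lambda>\<omega>. exp (- 1 * S (1/2) \<omega>)) \<le> expectation (\<lambda>_. exp (- 1))"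
  proof (rule integral_mono_AE)
    show "integrable P (\<lambda>\<omega>. exp (- 1 * S (1/2) \<omega>))"
      using subordinator_path(4)[OF subordinator, of _ "1/2"]
      by (intro integrable_const_bound[where B = 1]) auto
    show "AE \<omega> in P. exp (- 1 * S (1/2) \<omega>) \<le> exp (- 1)"
      using E0 by eventually_elim auto
  qed simp
  moreover have "expectation (\<lambda>\<omega>. exp (- 1 * S (1/2) \<omega>)) = exp (- (1/2) * 1 powr \<beta>)"
  proof -
    have "\<forall>t\<ge>0. \<forall>u\<ge>0. expectation (\<lambda>\<omega>. exp (- u * S t \<omega>)) = exp (- t * u powr \<beta>)"
      using stable by (simp add: stable_subordinator_def)
    from this[rule_format, of "1/2" 1] show ?thesis by simp
  qed
  ultimately show False by (simp add: prob_space)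
qed

end

section \<open>The Mittag-Leffler subordinator\<close>

locale ml_subordinator = prob_space P for P :: "'w measure" +
  fixes M :: "real \<Rightarrow> 'w \<Rightarrow> real" and \<alpha> \<rho> \<mu> :: real
  assumes \<alpha>: "0 < \<alpha>" "\<alpha> < 1" and \<rho>: "0 < \<rho>" and \<mu>: "0 < \<mu>"
    and mittag_leffler: "mittag_leffler_subordinator P \<alpha> \<rho> \<mu> M"
begin

lemma M_subordinator: "subordinator P M" and M_levy: "levy_process P M"
  using mittag_leffler by (auto simp: mittag_leffler_subordinator_def subordinator_def)

lemma M_measurable: "t \<ge> 0 \<Longrightarrow> M t \<in> borel_measurable P"
  using M_levy unfolding levy_process_def by blast

lemma M_nonneg: "t \<ge> 0 \<Longrightarrow> \<omega> \<in> space P \<Longrightarrow> M t \<omega> \<ge> 0"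
  using subordinator_path(4)[OF M_subordinator] .

lemma M_mono: "0 \<le> s \<Longrightarrow> s \<le> t \<Longrightarrow> \<omega> \<in> space P \<Longrightarrow> M s \<omega> \<le> M t \<omega>"
  using subordinator_path(3)[OF M_subordinator] .

definition laplace :: "real \<Rightarrow> real \<Rightarrow> real" where
  "laplace t u = (\<mu> / (\<mu> + u powr \<alpha>)) powr (\<rho> * t)"

lemma M_laplace:
  "t \<ge> 0 \<Longrightarrow> u \<ge> 0 \<Longrightarrow> expectation (\<lambda>\<omega>. exp (- u * M t \<omega>)) = laplace t u"
  using mittag_leffler unfolding mittag_leffler_subordinator_def laplace_def by blast

lemma integrable_exp_M:
  assumes "t \<ge> 0" "u \<ge> 0" shows "integrable P (\<lambda>\<omega>. exp (- u * M t \<omega>))"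
  using M_measurable[OF assms(1)] M_nonneg[OF assms(1)] assms
  by (intro integrable_const_bound[where B = 1]) (auto simp: mult_nonneg_nonneg)

lemma prob_M_le:
  assumes "t \<ge> 0" "u \<ge> 0"
  shows "prob {\<omega>\<in>space P. M t \<omega> \<le> x} \<le> exp (u * x) * laplace t u"
proof -
  note [measurable] = M_measurable[OF assms(1)]
  have "prob {\<omega>\<in>space P. M t \<omega> \<le> x} = expectation (indicator {\<omega>\<in>space P. M t \<omega> \<le> x})"
    by simp
  also have "\<dots> \<le> expectation (\<lambda>\<omega>. exp (u * x) * exp (- u * M t \<omega>))"
  proof (rule integral_mono)
    show "integrable P (indicat_real {\<omega>\<in>space P. M t \<omega> \<le> x})"
      by (intro integrable_const_bound[where B = 1]) (auto split: split_indicator)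
    show "indicat_real {\<omega>\<in>space P. M t \<omega> \<le> x} \<omega> \<le> exp (u * x) * exp (- u * M t \<omega>)" for \<omega>
      using assms by (auto split: split_indicator simp: exp_add[symmetric] intro: mult_left_mono)
  qed (rule integrable_mult_right[OF integrable_exp_M[OF assms]])
  also have "\<dots> = exp (u * x) * laplace t u"
    using M_laplace[OF assms] by simp
  finally show ?thesis .
qed

lemma prob_M_gt_le:
  assumes "t \<ge> 0" "\<delta> > 0"
  shows "prob {\<omega>\<in>space P. M t \<omega> > \<delta>} \<le> 2 * (1 - laplace t (1 / \<delta>))"
proof -
  note [measurable] = M_measurable[OF assms(1)]
  have u: "1 / \<delta> \<ge> 0" using assms by simp
  have int: "integrable P (\<lambda>\<omega>. 2 * (1 - exp (- (1 / \<delta>) * M t \<omega>)))"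
    by (intro integrable_mult_right Bochner_Integration.integrable_diff integrable_exp_M assms u) simp
  have "prob {\<omega>\<in>space P. M t \<omega> > \<delta>} = expectation (indicator {\<omega>\<in>space P. M t \<omega> > \<delta>})"
    by simp
  also have "\<dots> \<le> expectation (\<lambda>\<omega>. 2 * (1 - exp (- (1 / \<delta>) * M t \<omega>)))"
  proof (rule integral_mono[OF _ int])
    show "integrable P (indicat_real {\<omega>\<in>space P. M t \<omega> > \<delta>})"
      by (intro integrable_const_bound[where B = 1]) (auto split: split_indicator)
    fix \<omega> assume \<omega>: "\<omega> \<in> space P"
    have e: "exp (- 1) \<le> (1 / 2 :: real)"
      using exp_ge_add_one_self[of 1] by (simp add: exp_minus field_simps)
    show "indicat_real {\<omega>\<in>space P. M t \<omega> > \<delta>} \<omega> \<le> 2 * (1 - exp (- (1 / \<delta>) * M t \<omega>))"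
    proof -
      define y where "y = exp (- (1 / \<delta>) * M t \<omega>)"
      have "y \<le> exp (- 1)" if "M t \<omega> > \<delta>" using that assms by (simp add: y_def field_simps)
      then have "y \<le> 1 / 2" if "M t \<omega> > \<delta>" using that e by linarith
      moreover have "y \<le> 1" using M_nonneg[OF assms(1) \<omega>] assms by (simp add: y_def)
      ultimately have "indicat_real {\<omega>\<in>space P. M t \<omega> > \<delta>} \<omega> \<le> 2 * (1 - y)"
        using \<omega> by (cases "M t \<omega> > \<delta>") simp_all
      then show ?thesis by (simp only: y_def)
    qed
  qed
  also have "\<dots> = 2 * (1 - laplace t (1 / \<delta>))"
    using M_laplace[OF assms(1) u] integrable_exp_M[OF assms(1) u] by (simp add: prob_space)
  finally show ?thesis .
qed

text \<open>
  For small \<open>u\<close> the quantity \<open>1 - exp (- u * x)\<close> is negligible on \<open>x < 1\<close>, where it is at most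
  \<open>u * x \<le> 2 * u * (1 - exp (- x))\<close>. So a difference of two values of the Laplace transform detects the
  large values of \<open>M\<close>.
\<close>

lemma prob_M_ge_1:
  assumes "t \<ge> 0" "u \<ge> 0"
  shows "(1 - laplace t u) - 2 * u * (1 - laplace t 1) \<le> prob {\<omega>\<in>space P. M t \<omega> \<ge> 1}"
proof -
  note [measurable] = M_measurable[OF assms(1)]
  have i1: "integrable P (\<lambda>\<omega>. exp (- 1 * M t \<omega>))" using integrable_exp_M[OF assms(1), of 1] by simp
  note iu = integrable_exp_M[OF assms]
  have "(1 - laplace t u) - 2 * u * (1 - laplace t 1) =
     expectation (\<lambda>\<omega>. (1 - exp (- u * M t \<omega>)) - 2 * u * (1 - exp (- 1 * M t \<omega>)))"
    using M_laplace[OF assms] M_laplace[OF assms(1), of 1] i1 iu by (simp add: prob_space)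
  also have "\<dots> \<le> expectation (indicat_real {\<omega>\<in>space P. M t \<omega> \<ge> 1})"
  proof (rule integral_mono)
    show "integrable P (\<lambda>\<omega>. (1 - exp (- u * M t \<omega>)) - 2 * u * (1 - exp (- 1 * M t \<omega>)))"
      by (intro integrable_mult_right Bochner_Integration.integrable_diff iu i1) simp_all
    show "integrable P (indicat_real {\<omega>\<in>space P. M t \<omega> \<ge> 1})"
      by (intro integrable_const_bound[where B = 1]) (auto split: split_indicator)
    fix \<omega> assume \<omega>: "\<omega> \<in> space P"
    define x where "x = M t \<omega>"
    have x: "x \<ge> 0" using M_nonneg[OF assms(1) \<omega>] by (simp add: x_def)
    have "1 - exp (- u * x) - 2 * u * (1 - exp (- 1 * x)) \<le> (if x \<ge> 1 then 1 else 0)"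
    proof (cases "x \<ge> 1")
      case True
      have "2 * u * (1 - exp (- 1 * x)) \<ge> 0" using assms x by simp
      moreover have "exp (- u * x) \<ge> 0" by simp
      ultimately have "1 - exp (- u * x) - 2 * u * (1 - exp (- 1 * x)) \<le> 1" by linarith
      with True show ?thesis by simp
    next
      case False
      have "exp (- x) \<le> 1 / (1 + x)"
        using exp_ge_add_one_self[of x] x by (simp add: exp_minus field_simps)
      moreover have "1 - 1 / (1 + x) \<ge> x / 2" using x False by (simp add: field_simps mult_left_le)
      ultimately have "x / 2 \<le> 1 - exp (- x)" by linarith
      then have "2 * u * (x / 2) \<le> 2 * u * (1 - exp (- x))" using assms by (intro mult_left_mono) auto
      moreover have "1 - exp (- u * x) \<le> u * x" using exp_ge_add_one_self[of "- u * x"] by simp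
      ultimately show ?thesis using False by simp
    qed
    then show "(1 - exp (- u * M t \<omega>)) - 2 * u * (1 - exp (- 1 * M t \<omega>)) \<le> indicat_real {\<omega>\<in>space P. M t \<omega> \<ge> 1} \<omega>"
      using \<omega> by (cases "M t \<omega> \<ge> 1") (simp_all add: x_def)
  qed
  also have "\<dots> = prob {\<omega>\<in>space P. M t \<omega> \<ge> 1}" by simp
  finally show ?thesis .
qed

lemma laplace_exp: "laplace t u = exp (- (\<rho> * ln ((\<mu> + u powr \<alpha>) / \<mu>) * t))"
proof -
  have p: "\<mu> + u powr \<alpha> > 0" using \<mu> by (simp add: add_pos_nonneg)
  have "laplace t u = exp (\<rho> * t * ln (\<mu> / (\<mu> + u powr \<alpha>)))"
    using p \<mu> by (simp add: laplace_def powr_def[of "_ / _"])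
  also have "ln (\<mu> / (\<mu> + u powr \<alpha>)) = - ln ((\<mu> + u powr \<alpha>) / \<mu>)"
    using p \<mu> by (simp add: ln_div)
  finally show ?thesis by (simp add: mult_ac)
qed

lemma laplace_slope:
  "((\<lambda>s. (1 - laplace s u) / s) \<longlongrightarrow> \<rho> * ln ((\<mu> + u powr \<alpha>) / \<mu>)) (at_right 0)"
proof -
  define q where "q = ln ((\<mu> + u powr \<alpha>) / \<mu>)"
  have "((\<lambda>s. (1 - exp (- (\<rho> * q * s))) / s) \<longlongrightarrow> \<rho> * q) (at_right 0)"
    by real_asymp
  then show ?thesis unfolding laplace_exp by (simp add: q_def)
qed

text \<open>
  The Laplace exponent behaves like \<open>u\<^sup>\<alpha>\<close> near \<open>0\<close>, hence beats the linear correction in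
  \<open>prob_M_ge_1\<close> for small \<open>u\<close> because \<open>\<alpha> < 1\<close>.
\<close>

lemma prob_M_ge_1_linear:
  obtains c where "c > 0" "\<forall>\<^sub>F s in at_right 0. c * s \<le> prob {\<omega>\<in>space P. M s \<omega> \<ge> 1}"
proof -
  \<comment> \<open>the Laplace exponent at 1, up to the factor \<open>\<rho>\<close>\<close>
  define K where "K = ln ((\<mu> + 1) / \<mu>)"
  have "\<forall>\<^sub>F u in at_right 0. ln ((\<mu> + u powr \<alpha>) / \<mu>) > 2 * u * K"
    using \<alpha> \<mu> by real_asymp
  moreover have "\<forall>\<^sub>F u in at_right 0. (u::real) > 0" by (simp add: eventually_at_right_less)
  ultimately have "\<forall>\<^sub>F u in at_right 0. u > 0 \<and> ln ((\<mu> + u powr \<alpha>) / \<mu>) > 2 * u * K"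
    by eventually_elim auto
  then obtain u where u: "u > 0" "ln ((\<mu> + u powr \<alpha>) / \<mu>) > 2 * u * K"
    using eventually_happens[of _ "at_right (0::real)"] by (auto simp: trivial_limit_at_right_real)
  define d where "d = \<rho> * ln ((\<mu> + u powr \<alpha>) / \<mu>) - 2 * u * (\<rho> * K)"
  have "d > 0" using u \<rho> by (simp add: d_def algebra_simps)
  have "((\<lambda>s. (1 - laplace s u) / s - 2 * u * ((1 - laplace s 1) / s)) \<longlongrightarrow> d) (at_right 0)"
    unfolding d_def K_def using laplace_slope[of u] laplace_slope[of 1]
    by (intro tendsto_intros) auto
  then have "\<forall>\<^sub>F s in at_right 0. (1 - laplace s u) / s - 2 * u * ((1 - laplace s 1) / s) > d / 2"
    using \<open>d > 0\<close> by (intro order_tendstoD) auto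
  moreover have "\<forall>\<^sub>F s in at_right 0. (s::real) > 0" by (simp add: eventually_at_right_less)
  ultimately have "\<forall>\<^sub>F s in at_right 0. d / 2 * s \<le> prob {\<omega>\<in>space P. M s \<omega> \<ge> 1}"
  proof eventually_elim
    case (elim s)
    then have "d / 2 * s \<le> ((1 - laplace s u) / s - 2 * u * ((1 - laplace s 1) / s)) * s"
      by (intro mult_right_mono) auto
    also have "\<dots> = (1 - laplace s u) - 2 * u * (1 - laplace s 1)"
      using elim by (simp add: field_simps)
    also have "\<dots> \<le> prob {\<omega>\<in>space P. M s \<omega> \<ge> 1}" using u elim by (intro prob_M_ge_1) auto
    finally show ?case .
  qed
  then show ?thesis using \<open>d > 0\<close> by (intro that[of "d / 2"]) auto
qed

lemma expectation_M_increment: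
  fixes f g :: "real \<Rightarrow> real"
  assumes "s \<ge> 0" "h \<ge> 0" and [measurable]: "f \<in> borel_measurable borel" "g \<in> borel_measurable borel"
    and "\<And>x. \<bar>f x\<bar> \<le> B" "\<And>x. \<bar>g x\<bar> \<le> B"
  shows "expectation (\<lambda>\<omega>. f (M s \<omega>) * g (M (s + h) \<omega> - M s \<omega>)) =
    expectation (\<lambda>\<omega>. f (M s \<omega>)) * expectation (\<lambda>\<omega>. g (M h \<omega>))"
proof -
  note inc = levy_process_increment[OF prob_space_axioms M_levy assms(1,2)]
  have [measurable]: "M s \<in> borel_measurable P" "M h \<in> borel_measurable P" "M (s + h) \<in> borel_measurable P"
    using M_measurable assms by auto
  have ind: "indep_var borel (\<lambda>\<omega>. f (M s \<omega>)) borel (\<lambda>\<omega>. g (M (s + h) \<omega> - M s \<omega>))"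
    using indep_var_compose[OF inc(1) assms(3,4)] by (simp add: comp_def)
  have "expectation (\<lambda>\<omega>. f (M s \<omega>) * g (M (s + h) \<omega> - M s \<omega>)) =
    expectation (\<lambda>\<omega>. f (M s \<omega>)) * expectation (\<lambda>\<omega>. g (M (s + h) \<omega> - M s \<omega>))"
    by (rule indep_var_lebesgue_integral[OF ind])
       (use assms in \<open>auto intro!: integrable_const_bound[where B = B]\<close>)
  also have "expectation (\<lambda>\<omega>. g (M (s + h) \<omega> - M s \<omega>)) = integral\<^sup>L (distr P borel (\<lambda>\<omega>. M (s + h) \<omega> - M s \<omega>)) g"
    by (rule integral_distr[symmetric]) simp_all
  also have "\<dots> = expectation (\<lambda>\<omega>. g (M h \<omega>))"
    unfolding inc(2) by (rule integral_distr) simp_all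
  finally show ?thesis .
qed

end

section \<open>Negative correlation of silences\<close>

locale subordinated_stable_inverse =
  stable_inverse P S \<beta> rate + ml_subordinator P M \<alpha> \<rho> \<mu>
  for P :: "'w measure" and S M :: "real \<Rightarrow> 'w \<Rightarrow> real" and \<alpha> \<beta> \<rho> \<mu> rate :: real
begin

text \<open>
  The survival function continued by a constant to the negative reals, which makes it monotone and
  hence Borel measurable on the whole line.
\<close>

definition surv :: "real \<Rightarrow> real" where "surv x = survival (max 0 x)"

text \<open>
  For \<open>\<alpha> \<le> \<beta>\<close> the mean of \<open>mean_count (M s)\<close> is infinite, so it is truncated at a level \<open>K\<close>. The
  truncation also bounds the shift by which \<open>M s\<close> enters the survival function later on.
\<close>

definition cut_mean :: "real \<Rightarrow> real \<Rightarrow> real" where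
  "cut_mean K x = (if x \<le> K then mean_count (max 0 x) else 0)"

definition no_event :: "real \<Rightarrow> real" where
  "no_event t = expectation (\<lambda>\<omega>. surv (M t \<omega>))"

lemma surv_antimono: "x \<le> y \<Longrightarrow> surv y \<le> surv x"
  unfolding surv_def by (intro survival_antimono) auto

lemma surv_bounds: "0 \<le> surv x" "surv x \<le> 1"
  unfolding surv_def by (intro survival_bounds; simp)+

lemma surv_measurable [measurable]: "surv \<in> borel_measurable borel"
proof -
  have "mono (\<lambda>x. - surv x)" by (intro monoI) (simp add: surv_antimono)
  then have "(\<lambda>x. - surv x) \<in> borel_measurable borel" by (rule borel_measurable_mono)
  then show ?thesis by simp
qed

lemma cut_mean_measurable [measurable]: "cut_mean K \<in> borel_measurable borel"
proof -
  have "mono (\<lambda>x. mean_count (max 0 x))" by (intro monoI mean_count_mono) auto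
  then have [measurable]: "(\<lambda>x. mean_count (max 0 x)) \<in> borel_measurable borel" by (rule borel_measurable_mono)
  show ?thesis unfolding cut_mean_def[abs_def] by measurable
qed

lemma cut_mean_bounds: "0 \<le> cut_mean K x" "cut_mean K x \<le> mean_count (max 0 K)"
  unfolding cut_mean_def by (auto intro: mean_count_nonneg mean_count_mono)

lemma integrable_surv:
  assumes "f \<in> borel_measurable P" shows "integrable P (\<lambda>\<omega>. surv (f \<omega>))"
  using measurable_compose[OF assms surv_measurable] surv_bounds
  by (intro integrable_const_bound[where B = 1]) auto

lemma integrable_cut_mean:
  assumes "f \<in> borel_measurable P" shows "integrable P (\<lambda>\<omega>. cut_mean K (f \<omega>))"
  using measurable_compose[OF assms cut_mean_measurable] cut_mean_bounds
  by (intro integrable_const_bound[where B = "mean_count (max 0 K)"]) auto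

lemma no_event_bounds:
  assumes "t \<ge> 0" shows "0 \<le> no_event t" "no_event t \<le> 1"
proof -
  show "0 \<le> no_event t" unfolding no_event_def using surv_bounds by (intro integral_nonneg_AE) auto
  show "no_event t \<le> 1" unfolding no_event_def
    using surv_bounds by (intro integral_le_const integrable_surv M_measurable assms) auto
qed

lemma no_event_antimono:
  assumes "0 \<le> s" "s \<le> t" shows "no_event t \<le> no_event s"
  unfolding no_event_def
proof (rule integral_mono)
  show "surv (M t \<omega>) \<le> surv (M s \<omega>)" if "\<omega> \<in> space P" for \<omega>
    by (intro surv_antimono M_mono assms that)
qed (intro integrable_surv M_measurable; use assms in simp)+

text \<open>
  \<open>mean_count\<close> is dominated by a multiple of \<open>x\<^sup>\<beta>\<close>, which lies below the line of slope \<open>\<eta>\<close> beyond the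
  point \<open>y\<close> where the multiple of \<open>x\<^bsup>\<beta> - 1\<^esup>\<close> has dropped to \<open>\<eta>\<close>.
\<close>

lemma survival_subexponential:
  assumes "\<eta> > 0"
  obtains c where "c > 0" "\<And>x. x \<ge> 0 \<Longrightarrow> c * exp (- \<eta> * x) \<le> survival x"
proof -
  define C where "C = rate * exp 1"
  have "C > 0" using rate by (simp add: C_def)
  define y where "y = (\<eta> / C) powr (1 / (\<beta> - 1))"
  have "y > 0" using assms \<open>C > 0\<close> by (simp add: y_def)
  have "C * y powr (\<beta> - 1) = \<eta>"
    using \<beta> assms \<open>C > 0\<close> by (simp add: y_def powr_powr)
  have bound: "mean_count x \<le> mean_count y + \<eta> * x" if "x \<ge> 0" for x
  proof (cases "x \<le> y")
    case True
    have "mean_count x \<le> mean_count y" using True that by (intro mean_count_mono)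
    then show ?thesis using assms that by (simp add: add_increasing2)
  next
    case False
    then have "x > 0" using \<open>y > 0\<close> by simp
    have "mean_count x \<le> C * x powr \<beta>" using mean_count_le[OF \<open>x > 0\<close>] by (simp add: C_def)
    also have "\<dots> = C * x powr (\<beta> - 1) * x" using \<open>x > 0\<close> by (simp add: powr_diff)
    also have "\<dots> \<le> C * y powr (\<beta> - 1) * x"
      using False \<beta> \<open>y > 0\<close> \<open>C > 0\<close> \<open>x > 0\<close> by (intro mult_right_mono mult_left_mono powr_mono2') auto
    finally show ?thesis using \<open>C * y powr (\<beta> - 1) = \<eta>\<close> mean_count_nonneg[of y] by simp
  qed
  show ?thesis
  proof (rule that[of "exp (- mean_count y)"])
    fix x :: real assume "x \<ge> 0"
    have "exp (- mean_count y) * exp (- \<eta> * x) = exp (- (mean_count y + \<eta> * x))"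
      by (simp add: exp_add[symmetric])
    also have "\<dots> \<le> exp (- mean_count x)" using bound[OF \<open>x \<ge> 0\<close>] by simp
    also have "\<dots> \<le> survival x" by (rule survival_ge_exp_mean[OF \<open>x \<ge> 0\<close>])
    finally show "exp (- mean_count y) * exp (- \<eta> * x) \<le> survival x" .
  qed simp
qed

text \<open>
  Since \<open>surv\<close> dominates a multiple of \<open>exp (- \<eta> x)\<close>, \<open>no_event t\<close> dominates a multiple of
  \<open>laplace t \<eta>\<close>, which is geometric in \<open>t\<close> with a ratio tending to \<open>1\<close> as \<open>\<eta>\<close> tends to \<open>0\<close>.
\<close>

lemma no_event_not_geometric:
  assumes "h > 0" "0 < q" "q < 1" and decay: "\<And>n::nat. no_event (real (Suc n) * h) \<le> q ^ n"
  shows False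
proof -
  have "((\<lambda>\<eta>. laplace h \<eta>) \<longlongrightarrow> 1) (at_right 0)"
    unfolding laplace_def using \<alpha> \<mu> \<rho> assms by real_asymp
  then have "\<forall>\<^sub>F \<eta> in at_right 0. laplace h \<eta> > q" using assms by (intro order_tendstoD)
  moreover have "\<forall>\<^sub>F \<eta> in at_right 0. (\<eta>::real) > 0" by (simp add: eventually_at_right_less)
  ultimately have "\<forall>\<^sub>F \<eta> in at_right 0. \<eta> > 0 \<and> laplace h \<eta> > q" by eventually_elim auto
  then obtain \<eta> where \<eta>: "\<eta> > 0" "laplace h \<eta> > q"
    using eventually_happens[of _ "at_right (0::real)"] by (auto simp: trivial_limit_at_right_real)
  obtain c where c: "c > 0" "\<And>x. x \<ge> 0 \<Longrightarrow> c * exp (- \<eta> * x) \<le> survival x"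
    using survival_subexponential[OF \<eta>(1)] by blast
  define r where "r = laplace h \<eta>"
  have r: "r > q" "r > 0" using \<eta> assms by (simp_all add: r_def)
  have lower: "c * r ^ Suc n \<le> no_event (real (Suc n) * h)" for n
  proof -
    let ?t = "real (Suc n) * h"
    have t: "?t \<ge> 0" using assms by simp
    have "c * laplace ?t \<eta> = expectation (\<lambda>\<omega>. c * exp (- \<eta> * M ?t \<omega>))"
      using M_laplace[OF t, of \<eta>] \<eta> by simp
    also have "\<dots> \<le> no_event ?t" unfolding no_event_def
    proof (rule integral_mono)
      show "integrable P (\<lambda>\<omega>. c * exp (- \<eta> * M ?t \<omega>))"
        using integrable_exp_M[OF t, of \<eta>] \<eta> by (intro integrable_mult_right) auto
      show "integrable P (\<lambda>\<omega>. surv (M ?t \<omega>))" by (intro integrable_surv M_measurable t)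
      show "c * exp (- \<eta> * M ?t \<omega>) \<le> surv (M ?t \<omega>)" if "\<omega> \<in> space P" for \<omega>
        using c(2)[OF M_nonneg[OF t that]] M_nonneg[OF t that] by (simp add: surv_def max_absorb2)
    qed
    also have "laplace ?t \<eta> = r ^ Suc n"
    proof -
      have "laplace ?t \<eta> = r powr real (Suc n)"
        by (simp add: laplace_def r_def powr_powr mult_ac)
      also have "\<dots> = r ^ Suc n" using r(2) by (rule powr_realpow)
      finally show ?thesis .
    qed
    finally show ?thesis .
  qed
  have "c * r \<le> (q / r) ^ n" for n
  proof -
    have "c * r ^ Suc n \<le> q ^ n" using lower[of n] decay[of n] by (rule order.trans)
    then show ?thesis using r(2) by (simp add: power_divide field_simps)
  qed
  moreover have "(\<lambda>n. (q / r) ^ n) \<longlonglongrightarrow> 0"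
    using r assms by (intro LIMSEQ_power_zero) (simp add: field_simps)
  ultimately have "c * r \<le> 0" by (intro LIMSEQ_le_const) auto
  then show False using c(1) r(2) by (simp add: mult_le_0_iff)
qed

text \<open>
  In a suitable time \<open>h\<close> the subordinator moves by more than \<open>K\<close>, except with probability at most
  \<open>(1 - q) / 2\<close>. Thus waiting for another \<open>h\<close> reduces \<open>no_event\<close> at least by the factor
  \<open>q + (1 - q) / 2 < 1\<close>, whatever \<open>H\<close> is, and the decay is geometric.
\<close>

lemma shift_not_contracting:
  assumes "K \<ge> 0" "0 \<le> q" "q < 1"
    and shift: "\<And>H. H > 0 \<Longrightarrow> expectation (\<lambda>\<omega>. surv (K + M H \<omega>)) \<le> q * no_event H"
  shows False
proof -
  have "((\<lambda>h. exp (1 * K) * laplace h 1) \<longlongrightarrow> 0) at_top"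
  proof -
    define d where "d = \<rho> * ln ((\<mu> + 1) / \<mu>)"
    have "d > 0" using \<mu> \<rho> by (simp add: d_def)
    then have "((\<lambda>h. exp K * exp (- (d * h))) \<longlongrightarrow> 0) at_top" by real_asymp
    then show ?thesis by (simp add: laplace_exp d_def)
  qed
  then have "\<forall>\<^sub>F h in at_top. exp (1 * K) * laplace h 1 < (1 - q) / 2"
    using assms by (intro order_tendstoD) auto
  moreover have "\<forall>\<^sub>F h in at_top. (h::real) > 0" by (rule eventually_gt_at_top)
  ultimately have "\<forall>\<^sub>F h in at_top. (h::real) > 0 \<and> exp (1 * K) * laplace h 1 < (1 - q) / 2"
    by eventually_elim auto
  then obtain h where h: "h > 0" "exp (1 * K) * laplace h 1 < (1 - q) / 2"
    using eventually_happens[of _ "at_top :: real filter"] by auto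
  have small: "prob {\<omega>\<in>space P. M h \<omega> \<le> K} \<le> (1 - q) / 2"
    using prob_M_le[of h 1 K] h by simp
  let ?q = "(1 + q) / 2"
  have step: "no_event (H + h) \<le> ?q * no_event H" if H: "H > 0" for H
  proof -
    have [measurable]: "M H \<in> borel_measurable P" "M h \<in> borel_measurable P" "M (H + h) \<in> borel_measurable P"
      using H h by (auto intro!: M_measurable)
    have i1: "integrable P (\<lambda>\<omega>. surv (K + M H \<omega>))" by (intro integrable_surv) simp
    have i2: "integrable P (\<lambda>\<omega>. surv (M H \<omega>) * indicator {..K} (M (H + h) \<omega> - M H \<omega>))"
      using surv_bounds by (intro integrable_const_bound[where B = 1]) (auto split: split_indicator)
    have "no_event (H + h) \<le> expectation (\<lambda>\<omega>. surv (K + M H \<omega>) + surv (M H \<omega>) * indicator {..K} (M (H + h) \<omega> - M H \<omega>))"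
      unfolding no_event_def
    proof (rule integral_mono)
      show "integrable P (\<lambda>\<omega>. surv (M (H + h) \<omega>))" by (intro integrable_surv) simp
      show "integrable P (\<lambda>\<omega>. surv (K + M H \<omega>) + surv (M H \<omega>) * indicator {..K} (M (H + h) \<omega> - M H \<omega>))"
        by (intro Bochner_Integration.integrable_add i1 i2)
      fix \<omega> assume \<omega>: "\<omega> \<in> space P"
      show "surv (M (H + h) \<omega>) \<le> surv (K + M H \<omega>) + surv (M H \<omega>) * indicator {..K} (M (H + h) \<omega> - M H \<omega>)"
      proof (cases "M (H + h) \<omega> - M H \<omega> \<le> K")
        case True
        have "surv (M (H + h) \<omega>) \<le> surv (M H \<omega>)"
          using H h \<omega> by (intro surv_antimono M_mono) auto
        then show ?thesis using True surv_bounds(1)[of "K + M H \<omega>"] by simp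
      next
        case False
        then have "surv (M (H + h) \<omega>) \<le> surv (K + M H \<omega>)" by (intro surv_antimono) simp
        then show ?thesis using False by simp
      qed
    qed
    also have "\<dots> = expectation (\<lambda>\<omega>. surv (K + M H \<omega>)) + expectation (\<lambda>\<omega>. surv (M H \<omega>) * indicator {..K} (M (H + h) \<omega> - M H \<omega>))"
      by (rule Bochner_Integration.integral_add[OF i1 i2])
    also have "expectation (\<lambda>\<omega>. surv (M H \<omega>) * indicator {..K} (M (H + h) \<omega> - M H \<omega>)) =
        no_event H * expectation (\<lambda>\<omega>. indicator {..K} (M h \<omega>))"
      unfolding no_event_def using H h surv_bounds
      by (intro expectation_M_increment[where B = 1]) (auto split: split_indicator)
    also have "expectation (\<lambda>\<omega>. indicator {..K} (M h \<omega>)) = prob {\<omega>\<in>space P. M h \<omega> \<le> K}"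
    proof -
      have "expectation (\<lambda>\<omega>. indicat_real {..K} (M h \<omega>)) = expectation (indicator {\<omega>\<in>space P. M h \<omega> \<le> K})"
        by (intro Bochner_Integration.integral_cong) (auto split: split_indicator)
      then show ?thesis by simp
    qed
    also have "expectation (\<lambda>\<omega>. surv (K + M H \<omega>)) + no_event H * prob {\<omega>\<in>space P. M h \<omega> \<le> K}
       \<le> q * no_event H + no_event H * ((1 - q) / 2)"
      using shift[OF H] small no_event_bounds[of H] H by (intro add_mono mult_left_mono) auto
    also have "\<dots> = ?q * no_event H" by (simp add: field_simps)
    finally show ?thesis .
  qed
  have "no_event (real (Suc n) * h) \<le> ?q ^ n" for n
  proof (induction n)
    case 0
    show ?case using no_event_bounds[of h] h by simp
  next
    case (Suc n)
    have "no_event (real (Suc (Suc n)) * h) = no_event (real (Suc n) * h + h)"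
      by (rule arg_cong[where f = no_event]) (simp add: algebra_simps)
    also have "\<dots> \<le> ?q * no_event (real (Suc n) * h)" using h by (intro step) simp
    also have "\<dots> \<le> ?q * ?q ^ n" using Suc assms by (intro mult_left_mono) auto
    finally show ?case by simp
  qed
  then show False using no_event_not_geometric[of h ?q] h assms by simp
qed

text \<open>
  Up to the truncation, the mean of \<open>mean_count (M s)\<close> exceeds \<open>1 - no_event s\<close> by at least
  \<open>jensen_gap * P(M s \<ge> 1)\<close>, which is of order \<open>s\<close>. The excess needed is
  \<open>(1 - no_event s)\<^sup>2 / no_event s\<close>. Splitting at \<open>\<delta> = s\<^bsup>1/\<beta>\<^esup>\<close> shows \<open>1 - no_event s = O(s ln (1/s))\<close>: below \<open>\<delta>\<close>
  the bound \<open>1 - survival \<delta> \<le> mean_count \<delta> = O(\<delta>\<^sup>\<beta>)\<close> applies, and \<open>P(M s > \<delta>)\<close> is controlled by the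
  Laplace transform at \<open>1 / \<delta>\<close>. The square is therefore \<open>o(s)\<close>.
\<close>

lemma small_time_gap:
  obtains s K where "s > 0" "K \<ge> 0"
    "1 - no_event s < no_event s * expectation (\<lambda>\<omega>. cut_mean K (M s \<omega>))"
proof -
  define C where "C = rate * exp 1"
  define B where "B s = C * s + 2 * (1 - (\<mu> / (\<mu> + s powr (- (\<alpha> / \<beta>)))) powr (\<rho> * s))" for s
  have C: "C > 0" using rate by (simp add: C_def)
  have no_event_ge: "1 - no_event s \<le> B s" if s: "s > 0" for s
  proof -
    define \<delta> where "\<delta> = s powr (1 / \<beta>)"
    have \<delta>: "\<delta> > 0" "\<delta> powr \<beta> = s" "1 / \<delta> = s powr (- (1 / \<beta>))"
      using s \<beta> by (simp_all add: \<delta>_def powr_powr powr_minus_divide)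
    have [measurable]: "M s \<in> borel_measurable P" using s by (intro M_measurable) simp
    have i: "integrable P (\<lambda>\<omega>. C * s + indicat_real {\<omega>\<in>space P. M s \<omega> > \<delta>} \<omega>)"
      using C s by (intro integrable_const_bound[where B = "C * s + 1"]) (auto split: split_indicator)
    have j: "integrable P (indicat_real {\<omega>\<in>space P. M s \<omega> > \<delta>})"
      by (intro integrable_const_bound[where B = 1]) (auto split: split_indicator)
    have k: "integrable P (\<lambda>\<omega>. surv (M s \<omega>))" by (intro integrable_surv) simp
    have "1 - no_event s = expectation (\<lambda>\<omega>. 1 - surv (M s \<omega>))"
      using k by (simp add: no_event_def prob_space)
    also have "\<dots> \<le> expectation (\<lambda>\<omega>. C * s + indicat_real {\<omega>\<in>space P. M s \<omega> > \<delta>} \<omega>)"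
    proof (rule integral_mono[OF _ i])
      show "integrable P (\<lambda>\<omega>. 1 - surv (M s \<omega>))" using k by simp
      fix \<omega> assume \<omega>: "\<omega> \<in> space P"
      show "1 - surv (M s \<omega>) \<le> C * s + indicat_real {\<omega>\<in>space P. M s \<omega> > \<delta>} \<omega>"
      proof (cases "M s \<omega> > \<delta>")
        case True
        then show ?thesis using surv_bounds(1)[of "M s \<omega>"] C s \<omega> by (simp add: add_increasing)
      next
        case False
        then have "1 - surv (M s \<omega>) \<le> 1 - surv \<delta>" using surv_antimono[of "M s \<omega>" \<delta>] by simp
        also have "\<dots> \<le> mean_count \<delta>" using mean_count_ge[of \<delta>] \<delta>(1) by (simp add: surv_def max_absorb2)
        also have "\<dots> \<le> C * s" using mean_count_le[OF \<delta>(1)] \<delta>(2) by (simp add: C_def)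
        finally show ?thesis using False by simp
      qed
    qed
    also have "\<dots> = C * s + prob {\<omega>\<in>space P. M s \<omega> > \<delta>}" using j by (simp add: prob_space)
    also have "prob {\<omega>\<in>space P. M s \<omega> > \<delta>} \<le> 2 * (1 - laplace s (1 / \<delta>))"
      using prob_M_gt_le[OF _ \<delta>(1), of s] s by simp
    also have "laplace s (1 / \<delta>) = (\<mu> / (\<mu> + s powr (- (\<alpha> / \<beta>)))) powr (\<rho> * s)"
      unfolding laplace_def \<delta>(3) by (simp add: powr_powr)
    finally show ?thesis by (simp add: B_def)
  qed
  obtain c where c: "c > 0" "\<forall>\<^sub>F s in at_right 0. c * s \<le> prob {\<omega>\<in>space P. M s \<omega> \<ge> 1}"
    by (rule prob_M_ge_1_linear)
  let ?k = jensen_gap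
  define p where "p = \<alpha> / \<beta>"
  have p: "p > 0" using \<alpha> \<beta> by (simp add: p_def)
  have "((\<lambda>s. (B s)\<^sup>2 / s) \<longlongrightarrow> 0) (at_right 0)" "(B \<longlongrightarrow> 0) (at_right 0)"
    unfolding B_def[abs_def] p_def[symmetric] using p \<mu> \<rho> C by real_asymp+
  from order_tendstoD(2)[OF this(1), of "?k * c / 4"] order_tendstoD(2)[OF this(2), of "1 / 2"]
  have "\<forall>\<^sub>F s in at_right 0. (B s)\<^sup>2 / s < ?k * c / 4" "\<forall>\<^sub>F s in at_right 0. B s < 1 / 2"
    using c(1) jensen_gap_pos by simp_all
  moreover have "\<forall>\<^sub>F s in at_right 0. (s::real) > 0" by (simp add: eventually_at_right_less)
  ultimately have "\<forall>\<^sub>F s in at_right 0. s > 0 \<and> B s < 1 / 2 \<and> (B s)\<^sup>2 / s < ?k * c / 4 \<and>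
      c * s \<le> prob {\<omega>\<in>space P. M s \<omega> \<ge> 1}"
    using c(2) by eventually_elim auto
  then obtain s where s: "s > 0" "B s < 1 / 2" "(B s)\<^sup>2 / s < ?k * c / 4" "c * s \<le> prob {\<omega>\<in>space P. M s \<omega> \<ge> 1}"
    using eventually_happens[of _ "at_right (0::real)"] by (auto simp: trivial_limit_at_right_real)
  let ?L = "no_event s" and ?p = "prob {\<omega>\<in>space P. M s \<omega> \<ge> 1}"
  have L: "1 / 2 \<le> ?L" "?L \<le> 1" "1 - ?L \<le> B s"
    using no_event_ge[OF s(1)] s(2) no_event_bounds[of s] s(1) by auto
  have "(1 - ?L)\<^sup>2 \<le> (B s)\<^sup>2" using L by (intro power_mono) auto
  also have "\<dots> \<le> 4 * (B s)\<^sup>2 * ?L"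
    using L mult_left_mono[of 1 "4 * ?L" "(B s)\<^sup>2"] by (simp add: mult_ac)
  also have "4 * (B s)\<^sup>2 < ?k * (c * s)" using s(1,3) by (simp add: field_simps)
  then have "4 * (B s)\<^sup>2 * ?L < ?k * (c * s) * ?L" using L by (intro mult_strict_right_mono) auto
  also have "\<dots> \<le> ?k * ?p * ?L" using s(4) jensen_gap_pos L by (intro mult_right_mono mult_left_mono) auto
  finally have gap: "(1 - ?L)\<^sup>2 < ?k * ?p * ?L" by simp
  have lim: "((\<lambda>K. ?L * (?k * ?p - (1 + ?k) * (2 * (1 - laplace s (1 / K))))) \<longlongrightarrow>
      ?L * (?k * ?p - (1 + ?k) * (2 * (1 - 1)))) at_top"
  proof -
    have "((\<lambda>K. laplace s (1 / K)) \<longlongrightarrow> 1) at_top"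
      unfolding laplace_def using \<alpha> \<mu> \<rho> s(1) by real_asymp
    then show ?thesis by (intro tendsto_intros)
  qed
  have "\<forall>\<^sub>F K in at_top. (1 - ?L)\<^sup>2 < ?L * (?k * ?p - (1 + ?k) * (2 * (1 - laplace s (1 / K))))"
    using gap by (intro order_tendstoD(1)[OF lim]) (simp add: mult_ac)
  moreover have "\<forall>\<^sub>F K in at_top. (K::real) > 1" by (rule eventually_gt_at_top)
  ultimately have "\<forall>\<^sub>F K in at_top. 1 < K \<and> (1 - ?L)\<^sup>2 < ?L * (?k * ?p - (1 + ?k) * (2 * (1 - laplace s (1 / K))))"
    by eventually_elim auto
  then obtain K where K: "K > 1" "(1 - ?L)\<^sup>2 < ?L * (?k * ?p - (1 + ?k) * (2 * (1 - laplace s (1 / K))))"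
    using eventually_happens[of _ "at_top :: real filter"] by auto
  have [measurable]: "M s \<in> borel_measurable P" using s by (intro M_measurable) simp
  have ind: "integrable P (indicat_real {\<omega>\<in>space P. Q \<omega>})" if "Measurable.pred P Q" for Q
    using that by (intro integrable_const_bound[where B = 1]) (auto split: split_indicator)
  have k: "integrable P (\<lambda>\<omega>. surv (M s \<omega>))" by (intro integrable_surv) simp
  have int: "integrable P (\<lambda>\<omega>. 1 - surv (M s \<omega>) + ?k * indicat_real {\<omega>\<in>space P. M s \<omega> \<ge> 1} \<omega>
      - (1 + ?k) * indicat_real {\<omega>\<in>space P. M s \<omega> > K} \<omega>)"
    using k by (intro Bochner_Integration.integrable_diff Bochner_Integration.integrable_add integrable_mult_right ind) auto
  have "1 - ?L + ?k * ?p - (1 + ?k) * prob {\<omega>\<in>space P. M s \<omega> > K} =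
     expectation (\<lambda>\<omega>. 1 - surv (M s \<omega>) + ?k * indicat_real {\<omega>\<in>space P. M s \<omega> \<ge> 1} \<omega>
      - (1 + ?k) * indicat_real {\<omega>\<in>space P. M s \<omega> > K} \<omega>)"
    using k ind[of "\<lambda>\<omega>. M s \<omega> \<ge> 1"] ind[of "\<lambda>\<omega>. M s \<omega> > K"] by (simp add: no_event_def prob_space)
  also have "\<dots> \<le> expectation (\<lambda>\<omega>. cut_mean K (M s \<omega>))"
  proof (rule integral_mono[OF int])
    show "integrable P (\<lambda>\<omega>. cut_mean K (M s \<omega>))" by (intro integrable_cut_mean) simp
    fix \<omega> assume \<omega>: "\<omega> \<in> space P"
    define x where "x = M s \<omega>"
    have x: "x \<ge> 0" using M_nonneg[OF _ \<omega>, of s] s(1) by (simp add: x_def)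
    \<comment> \<open>beyond \<open>K\<close> the last term outweighs the first two, as \<open>cut_mean\<close> vanishes there\<close>
    have "1 - surv x + ?k * (if x \<ge> 1 then 1 else 0) - (1 + ?k) * (if x > K then 1 else 0) \<le> cut_mean K x"
    proof (cases "x > K")
      case True
      then show ?thesis using K surv_bounds(1)[of x] by (simp add: cut_mean_def)
    next
      case False
      then show ?thesis using x mean_count_ge[of x] mean_count_ge_gap[of x]
        by (auto simp: cut_mean_def surv_def max_absorb2)
    qed
    then show "1 - surv (M s \<omega>) + ?k * indicat_real {\<omega>\<in>space P. M s \<omega> \<ge> 1} \<omega>
      - (1 + ?k) * indicat_real {\<omega>\<in>space P. M s \<omega> > K} \<omega> \<le> cut_mean K (M s \<omega>)"
      using \<omega> unfolding x_def by (cases "M s \<omega> \<ge> 1"; cases "M s \<omega> > K") simp_all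
  qed
  finally have w: "1 - ?L + ?k * ?p - (1 + ?k) * prob {\<omega>\<in>space P. M s \<omega> > K} \<le> expectation (\<lambda>\<omega>. cut_mean K (M s \<omega>))" .
  have "(1 + ?k) * prob {\<omega>\<in>space P. M s \<omega> > K} \<le> (1 + ?k) * (2 * (1 - laplace s (1 / K)))"
    using prob_M_gt_le[of s K] s(1) K(1) jensen_gap_pos by (intro mult_left_mono) auto
  with w have w': "1 - ?L + (?k * ?p - (1 + ?k) * (2 * (1 - laplace s (1 / K)))) \<le> expectation (\<lambda>\<omega>. cut_mean K (M s \<omega>))"
    by linarith
  have "1 - ?L = ?L * (1 - ?L) + (1 - ?L)\<^sup>2" by (simp add: power2_eq_square algebra_simps)
  also have "\<dots> < ?L * (1 - ?L) + ?L * (?k * ?p - (1 + ?k) * (2 * (1 - laplace s (1 / K))))"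
    using K(2) by simp
  also have "\<dots> = ?L * (1 - ?L + (?k * ?p - (1 + ?k) * (2 * (1 - laplace s (1 / K)))))"
    by (simp only: distrib_left)
  also have "\<dots> \<le> ?L * expectation (\<lambda>\<omega>. cut_mean K (M s \<omega>))" using w' L by (intro mult_left_mono) auto
  finally show ?thesis using s(1) K(1) by (intro that[of s K]) auto
qed

text \<open>
  For the time-changed process this is the probability that no event occurs between \<open>s\<close> and
  \<open>t\<close>.
\<close>

definition silence :: "real \<Rightarrow> real \<Rightarrow> real" where
  "silence s t = expectation (\<lambda>\<omega>. expectation (\<lambda>\<omega>'. exp (- rate * \<bar>E (M t \<omega>) \<omega>' - E (M s \<omega>) \<omega>'\<bar>)))"

text \<open>
  Condition on \<open>M\<close>, apply \<open>silent_stretch_lower_bound\<close>, and replace \<open>M s\<close> by \<open>K\<close> inside the survival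
  function, which makes the two factors functions of independent increments.
\<close>

lemma silence_lower_bound:
  assumes s: "s > 0" and H: "H > 0" and K: "K \<ge> 0"
    and meas: "(\<lambda>\<omega>. expectation (\<lambda>\<omega>'. exp (- rate * \<bar>E (M (s + H) \<omega>) \<omega>' - E (M s \<omega>) \<omega>'\<bar>))) \<in> borel_measurable P"
  shows "no_event (s + H) + expectation (\<lambda>\<omega>. cut_mean K (M s \<omega>)) * expectation (\<lambda>\<omega>. surv (K + M H \<omega>)) \<le> silence s (s + H)"
proof -
  have [measurable]: "M s \<in> borel_measurable P" "M H \<in> borel_measurable P" "M (s + H) \<in> borel_measurable P"
    using s H by (auto intro!: M_measurable)
  let ?g = "\<lambda>\<omega>. expectation (\<lambda>\<omega>'. exp (- rate * \<bar>E (M (s + H) \<omega>) \<omega>' - E (M s \<omega>) \<omega>'\<bar>))"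
  have i1: "integrable P (\<lambda>\<omega>. surv (M (s + H) \<omega>))" by (intro integrable_surv) simp
  have i2: "integrable P (\<lambda>\<omega>. cut_mean K (M s \<omega>) * surv (K + (M (s + H) \<omega> - M s \<omega>)))"
  proof (rule integrable_const_bound[where B = "mean_count (max 0 K) * 1"])
    show "AE \<omega> in P. norm (cut_mean K (M s \<omega>) * surv (K + (M (s + H) \<omega> - M s \<omega>))) \<le> mean_count (max 0 K) * 1"
      unfolding real_norm_def abs_mult abs_of_nonneg[OF cut_mean_bounds(1)] abs_of_nonneg[OF surv_bounds(1)]
      by (intro AE_I2 mult_mono cut_mean_bounds surv_bounds mean_count_nonneg)
  qed simp
  have "no_event (s + H) + expectation (\<lambda>\<omega>. cut_mean K (M s \<omega>)) * expectation (\<lambda>\<omega>. surv (K + M H \<omega>))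
    = no_event (s + H) + expectation (\<lambda>\<omega>. cut_mean K (M s \<omega>) * surv (K + (M (s + H) \<omega> - M s \<omega>)))"
    using s H cut_mean_bounds surv_bounds mean_count_nonneg
    by (subst expectation_M_increment[where g = "\<lambda>x. surv (K + x)" and B = "mean_count (max 0 K) + 1"])
       (auto simp: abs_of_nonneg add_increasing add_increasing2)
  also have "\<dots> = expectation (\<lambda>\<omega>. surv (M (s + H) \<omega>) + cut_mean K (M s \<omega>) * surv (K + (M (s + H) \<omega> - M s \<omega>)))"
    unfolding no_event_def by (rule Bochner_Integration.integral_add[symmetric, OF i1 i2])
  also have "\<dots> \<le> expectation ?g"
  proof (rule integral_mono)
    show "integrable P (\<lambda>\<omega>. surv (M (s + H) \<omega>) + cut_mean K (M s \<omega>) * surv (K + (M (s + H) \<omega> - M s \<omega>)))"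
      by (intro Bochner_Integration.integrable_add i1 i2)
    show "integrable P ?g"
    proof (rule integrable_const_bound[where B = 1])
      show "AE \<omega> in P. norm (?g \<omega>) \<le> 1"
      proof (rule AE_I2)
        fix \<omega> assume \<omega>: "\<omega> \<in> space P"
        have [measurable]: "E (M (s + H) \<omega>) \<in> borel_measurable P" "E (M s \<omega>) \<in> borel_measurable P"
          using s H \<omega> by (auto intro!: inverse_measurable M_nonneg)
        have "integrable P (\<lambda>\<omega>'. exp (- rate * \<bar>E (M (s + H) \<omega>) \<omega>' - E (M s \<omega>) \<omega>'\<bar>))"
          using rate by (intro integrable_const_bound[where B = 1]) auto
        then have "?g \<omega> \<le> 1" using rate by (intro integral_le_const) auto
        moreover have "?g \<omega> \<ge> 0" by (intro integral_nonneg_AE) auto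
        ultimately show "norm (?g \<omega>) \<le> 1" by simp
      qed
    qed (rule meas)
    fix \<omega> assume \<omega>: "\<omega> \<in> space P"
    have a: "0 \<le> M s \<omega>" "M s \<omega> \<le> M (s + H) \<omega>" using s H \<omega> by (auto intro!: M_nonneg M_mono)
    have "cut_mean K (M s \<omega>) * surv (K + (M (s + H) \<omega> - M s \<omega>)) \<le> mean_count (M s \<omega>) * survival (M (s + H) \<omega>)"
    proof (cases "M s \<omega> \<le> K")
      case True
      then have "surv (K + (M (s + H) \<omega> - M s \<omega>)) \<le> survival (M (s + H) \<omega>)"
        using surv_antimono[of "M (s + H) \<omega>" "K + (M (s + H) \<omega> - M s \<omega>)"] a
        by (simp add: surv_def[of "M (s + H) \<omega>"] max_absorb2)
      then show ?thesis using True a mean_count_nonneg surv_bounds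
        by (auto simp: cut_mean_def max_absorb2 intro!: mult_left_mono)
    next
      case False
      then show ?thesis using mean_count_nonneg survival_bounds a by (simp add: cut_mean_def)
    qed
    moreover have "surv (M (s + H) \<omega>) = survival (M (s + H) \<omega>)" using a by (simp add: surv_def max_absorb2)
    ultimately have "surv (M (s + H) \<omega>) + cut_mean K (M s \<omega>) * surv (K + (M (s + H) \<omega> - M s \<omega>))
        \<le> (1 + mean_count (M s \<omega>)) * survival (M (s + H) \<omega>)" by (simp add: algebra_simps)
    also have "\<dots> \<le> ?g \<omega>" by (rule silent_stretch_lower_bound[OF a])
    finally show "surv (M (s + H) \<omega>) + cut_mean K (M s \<omega>) * surv (K + (M (s + H) \<omega> - M s \<omega>)) \<le> ?g \<omega>" .
  qed
  finally show ?thesis by (simp add: silence_def)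
qed

text \<open>
  If the correlation were nonnegative for all \<open>s\<close> and \<open>H\<close>, then the shift by \<open>K\<close> would contract \<open>no_event\<close> by
  the factor \<open>(1 - L) / (L w)\<close>, which is below \<open>1\<close> for the \<open>s\<close> and \<open>K\<close> of \<open>small_time_gap\<close>.
\<close>

theorem silence_negatively_correlated:
  assumes meas: "\<And>s t. s \<ge> 0 \<Longrightarrow> t \<ge> 0 \<Longrightarrow>
      (\<lambda>\<omega>. expectation (\<lambda>\<omega>'. exp (- rate * \<bar>E (M t \<omega>) \<omega>' - E (M s \<omega>) \<omega>'\<bar>))) \<in> borel_measurable P"
  shows "\<exists>s H. s > 0 \<and> H > 0 \<and> no_event (s + H) < no_event s * silence s (s + H)"
proof (rule ccontr)
  assume "\<not> ?thesis"
  then have pos: "no_event s * silence s (s + H) \<le> no_event (s + H)" if "s > 0" "H > 0" for s H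
    using that by (metis not_less)
  obtain s K where s: "s > 0" and K: "K \<ge> 0"
    and gap: "1 - no_event s < no_event s * expectation (\<lambda>\<omega>. cut_mean K (M s \<omega>))"
    by (rule small_time_gap)
  define L w where "L = no_event s" and "w = expectation (\<lambda>\<omega>. cut_mean K (M s \<omega>))"
  have L: "0 \<le> L" "L \<le> 1" using no_event_bounds[of s] s by (auto simp: L_def)
  have Lw: "1 - L < L * w" using gap by (simp add: L_def w_def)
  have "expectation (\<lambda>\<omega>. surv (K + M H \<omega>)) \<le> (1 - L) / (L * w) * no_event H" if H: "H > 0" for H
  proof -
    let ?J = "expectation (\<lambda>\<omega>. surv (K + M H \<omega>))"
    have "no_event (s + H) + w * ?J \<le> silence s (s + H)"
      unfolding w_def using s H K by (intro silence_lower_bound meas) auto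
    then have "L * (no_event (s + H) + w * ?J) \<le> L * silence s (s + H)" using L by (intro mult_left_mono)
    also have "\<dots> \<le> no_event (s + H)" unfolding L_def by (rule pos[OF s H])
    finally have "L * w * ?J \<le> (1 - L) * no_event (s + H)" by (simp add: algebra_simps)
    also have "\<dots> \<le> (1 - L) * no_event H" using L s H by (intro mult_left_mono no_event_antimono) auto
    finally show ?thesis using Lw L by (simp add: field_simps)
  qed
  moreover have "0 \<le> (1 - L) / (L * w)" "(1 - L) / (L * w) < 1"
    using Lw L by (simp_all add: field_simps)
  ultimately show False using K by (intro shift_not_contracting)
qed

end

section \<open>The generalized fractional negative binomial process\<close>

text \<open>
  A continuous function that restricts to the indicator of equality on the naturals; the time-change
  formula asks for continuous test functions.
\<close>

definition same :: "real \<Rightarrow> real \<Rightarrow> real" where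
  "same x y = max 0 (1 - \<bar>x - y\<bar>)"

lemma same_nat: "same (real m) (real n) = of_bool (m = n)"
proof (cases "m = n")
  case False
  then have "\<bar>real m - real n\<bar> \<ge> 1" by linarith
  then show ?thesis using False by (simp add: same_def)
qed (simp add: same_def)

lemma same_bounded: "\<bar>same x y\<bar> \<le> 1" by (simp add: same_def)

lemma same_continuous: "continuous_on UNIV (\<lambda>p. same (fst p) (snd p))"
  unfolding same_def by (intro continuous_intros)

lemma same_0_continuous: "continuous_on UNIV (\<lambda>p. same 0 (snd p))"
  unfolding same_def by (intro continuous_intros)

lemma poisson_process_prob_silent:
  assumes P: "prob_space P" and N: "poisson_process P rate N" and "rate > 0" "0 \<le> r" "0 \<le> h"
  shows "measure P {\<omega>\<in>space P. N (r + h) \<omega> = N r \<omega>} = exp (- rate * h)"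
proof -
  interpret prob_space P by fact
  have L: "levy_process P (\<lambda>t \<omega>. real (N t \<omega>))" using N by (simp add: poisson_process_def)
  have Nm: "(\<lambda>\<omega>. real (N t \<omega>)) \<in> borel_measurable P" if "t \<ge> 0" for t
    using L that unfolding levy_process_def by blast
  have [measurable]: "N h \<in> measurable P (count_space UNIV)"
  proof -
    have "(\<lambda>\<omega>. nat \<lfloor>real (N h \<omega>)\<rfloor>) \<in> measurable P (count_space UNIV)"
      using Nm[of h] assms by measurable
    then show ?thesis by simp
  qed
  have "measure P {\<omega>\<in>space P. N (r + h) \<omega> = N r \<omega>} = 
     measure P {\<omega>\<in>space P. real (N r \<omega>) \<in> UNIV \<and> real (N (r + h) \<omega>) - real (N r \<omega>) \<in> {0}}"
    by (rule arg_cong[where f = "measure P"]) auto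
  also have "\<dots> = measure P {\<omega>\<in>space P. real (N r \<omega>) \<in> UNIV} * measure P {\<omega>\<in>space P. real (N h \<omega>) \<in> {0}}"
    by (rule levy_process_prob_increment[OF P L]) (use assms in auto)
  also have "\<dots> = measure P {\<omega>\<in>space P. N h \<omega> = 0}"
    by (simp add: prob_space)
  also have "\<dots> = exp (- rate * h)"
  proof (cases "h = 0")
    case True
    have "\<forall>\<omega>\<in>space P. real (N 0 \<omega>) = 0" using L unfolding levy_process_def by blast
    then have "{\<omega>\<in>space P. N h \<omega> = 0} = space P" using True by auto
    then show ?thesis using True by (simp add: prob_space)
  next
    case False
    have "measure P {\<omega>\<in>space P. N h \<omega> = 0} = measure (distr P (count_space UNIV) (N h)) {0}"
      by (subst measure_distr) (auto intro!: arg_cong[where f = "measure P"])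
    also have "distr P (count_space UNIV) (N h) = measure_pmf (poisson_pmf (rate * h))"
      using N False assms by (auto simp: poisson_process_def)
    also have "measure (measure_pmf (poisson_pmf (rate * h))) {0} = exp (- rate * h)"
    proof -
      have "0 < rate * h" using False assms by simp
      then show ?thesis by (simp add: measure_pmf_single)
    qed
    finally show ?thesis .
  qed
  finally show ?thesis .
qed

lemma poisson_process_expectation_same:
  assumes P: "prob_space P" and N: "poisson_process P rate N" and "rate > 0" "0 \<le> r" "0 \<le> r'"
  shows "(\<integral>\<omega>. same (real (N r \<omega>)) (real (N r' \<omega>)) \<partial>P) = exp (- rate * \<bar>r' - r\<bar>)"
proof -
  interpret prob_space P by fact
  have "(\<integral>\<omega>. same (real (N r \<omega>)) (real (N r' \<omega>)) \<partial>P) = (\<integral>\<omega>. indicat_real {\<omega>\<in>space P. N r \<omega> = N r' \<omega>} \<omega> \<partial>P)"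
    by (rule Bochner_Integration.integral_cong) (auto simp: same_nat)
  also have "\<dots> = measure P {\<omega>\<in>space P. N r \<omega> = N r' \<omega>}"
    by (simp, rule arg_cong[where f = prob], auto)
  also have "\<dots> = exp (- rate * \<bar>r' - r\<bar>)"
  proof (cases "r \<le> r'")
    case True
    then show ?thesis using poisson_process_prob_silent[OF assms(1-4), of "r' - r"] by (simp add: eq_commute)
  next
    case False
    then show ?thesis using poisson_process_prob_silent[OF assms(1-3,5), of "r - r'"] assms by simp
  qed
  finally show ?thesis .
qed

text \<open>
  A bounded continuous test function whose zero set is the order relation. It carries the almost sure
  monotonicity of the Poisson process through both time changes: paths of a Poisson process are not
  monotone by definition, but each increment is almost surely nonnegative.
\<close>

definition excess :: "real \<Rightarrow> real \<Rightarrow> real" where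
  "excess x y = min 1 (max 0 (x - y))"

lemma excess_bounded: "\<bar>excess x y\<bar> \<le> 1" by (simp add: excess_def)

lemma excess_continuous: "continuous_on UNIV (\<lambda>p. excess (fst p) (snd p))"
  unfolding excess_def by (intro continuous_intros)

lemma excess_nonneg: "excess x y \<ge> 0" by (simp add: excess_def)

lemma excess_eq_0_iff: "excess x y = 0 \<longleftrightarrow> x \<le> y" by (auto simp: excess_def min_def max_def)

lemma poisson_process_expectation_excess:
  assumes P: "prob_space P" and N: "poisson_process P rate N" and "0 \<le> r" "r \<le> r'"
  shows "(\<integral>\<omega>. excess (real (N r \<omega>)) (real (N r' \<omega>)) \<partial>P) = 0"
proof -
  interpret prob_space P by fact
  have L: "levy_process P (\<lambda>t \<omega>. real (N t \<omega>))" using N by (simp add: poisson_process_def)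
  have Nm: "(\<lambda>\<omega>. real (N t \<omega>)) \<in> borel_measurable P" if "t \<ge> 0" for t
    using L that unfolding levy_process_def by blast
  note [measurable] = Nm[OF assms(3)] Nm[OF order.trans[OF assms(3,4)]]
  have "prob {\<omega>\<in>space P. real (N r \<omega>) \<in> UNIV \<and> real (N (r + (r' - r)) \<omega>) - real (N r \<omega>) \<in> {..<0}} = 0"
    by (subst levy_process_prob_increment[OF P L]) (use assms in auto)
  then have "prob {\<omega>\<in>space P. real (N r' \<omega>) < real (N r \<omega>)} = 0" by simp
  moreover have "{\<omega>\<in>space P. real (N r' \<omega>) < real (N r \<omega>)} \<in> events" by measurable
  ultimately have "{\<omega>\<in>space P. real (N r' \<omega>) < real (N r \<omega>)} \<in> null_sets P"
    by (intro null_setsI) (simp only: emeasure_eq_measure ennreal_0)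
  then have "AE \<omega> in P. \<omega> \<notin> {\<omega>\<in>space P. real (N r' \<omega>) < real (N r \<omega>)}" by (rule AE_not_in)
  with AE_space have "AE \<omega> in P. excess (real (N r \<omega>)) (real (N r' \<omega>)) = 0"
    by eventually_elim (simp add: excess_eq_0_iff)
  then show ?thesis by (rule integral_eq_zero_AE)
qed

text \<open>
  The pair \<open>(G s, G (s + H) - G s)\<close> consists of additive functionals of the law at the times \<open>s\<close> and
  \<open>s + H\<close> and is almost surely nonnegative, so infinite divisibility would make its zero sets positively
  correlated. The two time changes identify the three probabilities involved as \<open>no_event s\<close>, \<open>silence s (s + H)\<close> and
  \<open>no_event (s + H)\<close>.
\<close>

theorem theorem3p2:
  fixes P :: "'w measure"
    and N :: "real \<Rightarrow> 'w \<Rightarrow> nat"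
    and S M :: "real \<Rightarrow> 'w \<Rightarrow> real"
    and \<alpha> \<beta> \<rho> \<mu> rate :: real
  assumes "prob_space P"
    and "0 < \<alpha>" "\<alpha> < 1" "0 < \<beta>" "\<beta> < 1"
    and "0 < \<rho>" "0 < \<mu>" "0 < rate"
    and "poisson_process P rate N"
    and "stable_subordinator P \<beta> S"
    and "mittag_leffler_subordinator P \<alpha> \<rho> \<mu> M"
    and "indep_processes P (\<lambda>t \<omega>. real (N t \<omega>)) (inverse_subordinator S)"
    and "indep_processes P M (\<lambda>t \<omega>. real (fractional_poisson N S t \<omega>))"
  shows "\<not> infinitely_divisible_process P (\<lambda>t \<omega>. real (gfnbp N S M t \<omega>))"
proof
  let ?N = "\<lambda>t \<omega>. real (N t \<omega>)" and ?E = "inverse_subordinator S"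
  let ?F = "\<lambda>t \<omega>. real (fractional_poisson N S t \<omega>)"
  let ?G = "\<lambda>t \<omega>. real (gfnbp N S M t \<omega>)"
  interpret prob_space P by fact
  have N_levy: "levy_process P ?N" using assms(9) by (simp add: poisson_process_def)
  have N_cadlag: "cadlag (\<lambda>t. ?N t \<omega>)" if "\<omega> \<in> space P" for \<omega>
    using N_levy that unfolding levy_process_def by blast
  have N_0: "N 0 \<omega> = 0" if "\<omega> \<in> space P" for \<omega>
  proof -
    have "\<forall>\<omega>\<in>space P. real (N 0 \<omega>) = 0" using N_levy unfolding levy_process_def by blast
    then show ?thesis using that by simp
  qed
  have indN: "indep_var (PiM {0..} (\<lambda>_. borel)) (\<lambda>\<omega>. \<lambda>t\<in>{0..}. ?E t \<omega>)
      (PiM {0..} (\<lambda>_. borel)) (\<lambda>\<omega>. \<lambda>t\<in>{0..}. ?N t \<omega>)"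
    using indep_processes_sym[OF assms(1,12)] by (simp only: indep_processes_def)
  have indM: "indep_var (PiM {0..} (\<lambda>_. borel)) (\<lambda>\<omega>. \<lambda>t\<in>{0..}. M t \<omega>)
      (PiM {0..} (\<lambda>_. borel)) (\<lambda>\<omega>. \<lambda>t\<in>{0..}. ?F t \<omega>)"
    using assms(13) by (simp only: indep_processes_def)
  have N_right: "continuous (at_right t) (\<lambda>t. ?N t \<omega>)" if "t \<ge> 0" "\<omega> \<in> space P" for t \<omega>
    using N_cadlag[OF that(2)] that(1) unfolding cadlag_def by blast
  have F_eq: "?F t \<omega> = ?N (?E t \<omega>) \<omega>" for t \<omega>
    by (simp add: fractional_poisson_def time_change_def)
  have G_eq: "?G t \<omega> = ?F (M t \<omega>) \<omega>" for t \<omega>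
    by (simp add: gfnbp_def time_change_def)
  have F_right: "continuous (at_right t) (\<lambda>t. ?F t \<omega>)" if "t \<ge> 0" "\<omega> \<in> space P" for t \<omega>
    unfolding F_eq by (rule cadlag_inverse_subordinator_right_continuous[OF N_cadlag[OF that(2)] that(1)])
  note E_meas = time_change_components_measurable(1)[OF indN inverse_subordinator_nonneg N_right]
  interpret subordinated_stable_inverse P S M \<alpha> \<beta> \<rho> \<mu> rate
    by unfold_locales (use assms E_meas in auto)
  note changeN = expectation_independent_time_change[OF indN E_nonneg N_right]
  note changeM = expectation_independent_time_change[OF indM M_nonneg F_right]
  have F_same: "expectation (\<lambda>\<omega>. same (?F a \<omega>) (?F b \<omega>)) = expectation (\<lambda>\<omega>. exp (- rate * \<bar>E b \<omega> - E a \<omega>\<bar>))"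
    if "a \<ge> 0" "b \<ge> 0" for a b
    unfolding F_eq
    using changeN(1)[OF _ _ same_continuous same_bounded that]
    by (simp add: poisson_process_expectation_same[OF assms(1,9,8)])
  \<comment> \<open>comparing with \<open>N 0 = 0\<close> reduces the probability of no event up to \<open>b\<close> to that of a silent stretch\<close>
  have F_zero: "expectation (\<lambda>\<omega>. same 0 (?F b \<omega>)) = survival b" if "b \<ge> 0" for b
  proof -
    have "expectation (\<lambda>\<omega>'. same 0 (?N r \<omega>')) = exp (- rate * r)" if "r \<ge> 0" for r
    proof -
      have "expectation (\<lambda>\<omega>'. same 0 (?N r \<omega>')) = expectation (\<lambda>\<omega>'. same (?N 0 \<omega>') (?N r \<omega>'))"
        by (rule Bochner_Integration.integral_cong) (simp_all add: N_0)
      then show ?thesis using poisson_process_expectation_same[OF assms(1,9,8), of 0 r] that by simp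
    qed
    then show ?thesis unfolding F_eq survival_def
      using changeN(1)[OF _ _ same_0_continuous same_bounded that that] by simp
  qed
  have G_meas: "?G t \<in> borel_measurable P" if "t \<ge> 0" for t
    unfolding G_eq by (rule independent_time_change_measurable[OF indM M_nonneg F_right that])
  have silence_meas: "(\<lambda>\<omega>. expectation (\<lambda>\<omega>'. exp (- rate * \<bar>E (M t \<omega>) \<omega>' - E (M s \<omega>) \<omega>'\<bar>))) \<in> borel_measurable P"
    if "s \<ge> 0" "t \<ge> 0" for s t
  proof -
    have "(\<lambda>\<omega>. expectation (\<lambda>\<omega>'. same (?F (M s \<omega>) \<omega>') (?F (M t \<omega>) \<omega>'))) \<in> borel_measurable P"
      by (rule changeM(2)[OF _ _ _ _ same_continuous same_bounded that])
    moreover have "expectation (\<lambda>\<omega>'. same (?F (M s \<omega>) \<omega>') (?F (M t \<omega>) \<omega>')) =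
        expectation (\<lambda>\<omega>'. exp (- rate * \<bar>E (M t \<omega>) \<omega>' - E (M s \<omega>) \<omega>'\<bar>))" if "\<omega> \<in> space P" for \<omega>
      by (rule F_same) (use M_nonneg that \<open>s \<ge> 0\<close> \<open>t \<ge> 0\<close> in auto)
    ultimately show ?thesis by (subst (asm) measurable_cong) auto
  qed
  have prob_same: "prob {\<omega>\<in>space P. gfnbp N S M s \<omega> = gfnbp N S M t \<omega>} = silence s t" if "s \<ge> 0" "t \<ge> 0" for s t
  proof -
    have "prob {\<omega>\<in>space P. gfnbp N S M s \<omega> = gfnbp N S M t \<omega>} =
        expectation (indicator {\<omega>\<in>space P. gfnbp N S M s \<omega> = gfnbp N S M t \<omega>})"
      by (simp, rule arg_cong[where f = prob], auto)
    also have "\<dots> = expectation (\<lambda>\<omega>. same (?G s \<omega>) (?G t \<omega>))"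
      by (rule Bochner_Integration.integral_cong) (auto simp: same_nat)
    also have "\<dots> = expectation (\<lambda>\<omega>. expectation (\<lambda>\<omega>'. same (?F (M s \<omega>) \<omega>') (?F (M t \<omega>) \<omega>')))"
      unfolding G_eq by (rule changeM(1)[OF _ _ _ _ same_continuous same_bounded that])
    also have "\<dots> = silence s t" unfolding silence_def
      by (rule Bochner_Integration.integral_cong[OF refl], rule F_same) (use M_nonneg that in auto)
    finally show ?thesis .
  qed
  have prob_zero: "prob {\<omega>\<in>space P. gfnbp N S M t \<omega> = 0} = no_event t" if "t \<ge> 0" for t
  proof -
    have "prob {\<omega>\<in>space P. gfnbp N S M t \<omega> = 0} = expectation (indicator {\<omega>\<in>space P. gfnbp N S M t \<omega> = 0})"
      by (simp, rule arg_cong[where f = prob], auto)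
    also have "\<dots> = expectation (\<lambda>\<omega>. same 0 (?G t \<omega>))"
      by (rule Bochner_Integration.integral_cong) (auto simp: same_nat[of 0, simplified])
    also have "\<dots> = expectation (\<lambda>\<omega>. expectation (\<lambda>\<omega>'. same 0 (?F (M t \<omega>) \<omega>')))"
      unfolding G_eq by (rule changeM(1)[OF _ _ _ _ same_0_continuous same_bounded that that])
    also have "\<dots> = no_event t" unfolding no_event_def
      by (rule Bochner_Integration.integral_cong[OF refl], subst F_zero)
         (use M_nonneg that in \<open>auto simp: surv_def max_absorb2\<close>)
    finally show ?thesis .
  qed
  \<comment> \<open>the excess of an earlier over a later value has mean zero after each of the two time changes\<close>
  have G_mono: "AE \<omega> in P. ?G s \<omega> \<le> ?G t \<omega>" if "0 \<le> s" "s \<le> t" for s t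
  proof -
    have t: "0 \<le> t" using that by simp
    have F_excess: "expectation (\<lambda>\<omega>. excess (?F a \<omega>) (?F b \<omega>)) = 0" if "0 \<le> a" "a \<le> b" for a b
    proof -
      have "expectation (\<lambda>\<omega>. excess (?F a \<omega>) (?F b \<omega>)) =
          expectation (\<lambda>\<omega>. expectation (\<lambda>\<omega>'. excess (?N (E a \<omega>) \<omega>') (?N (E b \<omega>) \<omega>')))"
        unfolding F_eq by (rule changeN(1)[OF _ _ excess_continuous excess_bounded]) (use that in auto)
      also have "\<dots> = 0"
      proof (rule integral_eq_zero_AE)
        show "AE \<omega> in P. expectation (\<lambda>\<omega>'. excess (?N (E a \<omega>) \<omega>') (?N (E b \<omega>) \<omega>')) = 0"
          using AE_E_mono
        proof eventually_elim
          case (elim \<omega>)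
          show ?case by (rule poisson_process_expectation_excess[OF assms(1,9)]) (use elim that in auto)
        qed
      qed
      finally show ?thesis .
    qed
    have "expectation (\<lambda>\<omega>. excess (?G s \<omega>) (?G t \<omega>)) =
        expectation (\<lambda>\<omega>. expectation (\<lambda>\<omega>'. excess (?F (M s \<omega>) \<omega>') (?F (M t \<omega>) \<omega>')))"
      unfolding G_eq by (rule changeM(1)[OF _ _ _ _ excess_continuous excess_bounded that(1) t])
    also have "\<dots> = expectation (\<lambda>_. 0)"
      by (rule Bochner_Integration.integral_cong[OF refl], rule F_excess) (use M_nonneg M_mono that in auto)
    finally have zero: "expectation (\<lambda>\<omega>. excess (?G s \<omega>) (?G t \<omega>)) = 0" by simp
    have "integrable P (\<lambda>\<omega>. excess (?G s \<omega>) (?G t \<omega>))"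
    proof (rule integrable_const_bound[where B = 1])
      note [measurable] = G_meas[OF that(1)] G_meas[OF t]
      show "(\<lambda>\<omega>. excess (?G s \<omega>) (?G t \<omega>)) \<in> borel_measurable P"
        unfolding excess_def by measurable
    qed (use excess_bounded in auto)
    then have "AE \<omega> in P. excess (?G s \<omega>) (?G t \<omega>) = 0"
      using zero by (subst (asm) integral_nonneg_eq_0_iff_AE) (auto simp: excess_nonneg)
    then show ?thesis by eventually_elim (simp add: excess_eq_0_iff)
  qed
  obtain s H where s: "s > 0" and H: "H > 0" and neg: "no_event (s + H) < no_event s * silence s (s + H)"
    using silence_negatively_correlated[OF silence_meas] by blast
  let ?t = "s + H" and ?J = "{s, s + H}"
  let ?\<nu> = "finite_dim_distr P ?G ?J" and ?S = "PiM ?J (\<lambda>_. borel :: real measure)"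
  let ?path = "\<lambda>\<omega>. \<lambda>t\<in>?J. ?G t \<omega>"
  have path [measurable]: "?path \<in> measurable P ?S"
    by (rule measurable_restrict) (use G_meas s H in auto)
  have coord [measurable]: "(\<lambda>x. x s) \<in> borel_measurable ?S" "(\<lambda>x. x ?t) \<in> borel_measurable ?S"
    by (auto intro!: measurable_component_singleton)
  have pred_v: "Measurable.pred ?S (\<lambda>x. x ?t - x s = 0)" by measurable
  have pred_uv: "Measurable.pred ?S (\<lambda>x. x s = 0 \<and> x ?t - x s = 0)" by measurable
  have AE_\<nu>: "AE x in ?\<nu>. Q x" if "Measurable.pred ?S Q" "\<And>\<omega>. \<omega> \<in> space P \<Longrightarrow> Q (?path \<omega>)" for Q
    unfolding finite_dim_distr_def using that by (subst AE_distr_iff) auto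
  have prob_\<nu>: "measure ?\<nu> {x\<in>space ?\<nu>. Q x} = prob {\<omega>\<in>space P. Q (?path \<omega>)}" if "Measurable.pred ?S Q" for Q
  proof -
    have "measure ?\<nu> {x\<in>space ?\<nu>. Q x} = measure ?\<nu> {x\<in>space ?S. Q x}" by (simp add: finite_dim_distr_def)
    also have "\<dots> = prob (?path -` {x\<in>space ?S. Q x} \<inter> space P)"
      unfolding finite_dim_distr_def using that by (subst measure_distr) auto
    also have "?path -` {x\<in>space ?S. Q x} \<inter> space P = {\<omega>\<in>space P. Q (?path \<omega>)}"
      using measurable_space[OF path] by auto
    finally show ?thesis .
  qed
  assume "infinitely_divisible_process P ?G"
  then have "infinitely_divisible ?J ?\<nu>" using s H by (auto simp: infinitely_divisible_process_def)
  moreover have "(\<lambda>x. x ?t - x s) \<in> borel_measurable ?S" by simp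
  moreover have "AE x in ?\<nu>. x s \<ge> 0" by (rule AE_\<nu>) auto
  moreover have "AE x in ?\<nu>. x ?t - x s \<ge> 0"
    unfolding finite_dim_distr_def by (subst AE_distr_iff) (use G_mono[of s ?t] s H in auto)
  ultimately have "measure ?\<nu> {x\<in>space ?\<nu>. x s = 0} * measure ?\<nu> {x\<in>space ?\<nu>. x ?t - x s = 0}
      \<le> measure ?\<nu> {x\<in>space ?\<nu>. x s = 0 \<and> x ?t - x s = 0}"
    using coord(1) by (intro infinitely_divisible_zero_sets_positively_correlated) (auto simp: sum_subtractf)
  moreover have "measure ?\<nu> {x\<in>space ?\<nu>. x s = 0} = no_event s"
    using prob_zero[of s] s by (subst prob_\<nu>) auto
  moreover have "measure ?\<nu> {x\<in>space ?\<nu>. x ?t - x s = 0} = silence s ?t"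
  proof -
    have "{\<omega>\<in>space P. ?path \<omega> ?t - ?path \<omega> s = 0} = {\<omega>\<in>space P. gfnbp N S M s \<omega> = gfnbp N S M ?t \<omega>}"
      by auto
    then show ?thesis using prob_same[of s ?t] s H by (simp only: prob_\<nu>[OF pred_v])
  qed
  moreover have "measure ?\<nu> {x\<in>space ?\<nu>. x s = 0 \<and> x ?t - x s = 0} \<le> no_event ?t"
  proof -
    have "measure ?\<nu> {x\<in>space ?\<nu>. x s = 0 \<and> x ?t - x s = 0}
       = prob {\<omega>\<in>space P. gfnbp N S M s \<omega> = 0 \<and> gfnbp N S M ?t \<omega> = gfnbp N S M s \<omega>}"
      unfolding prob_\<nu>[OF pred_uv] by (rule arg_cong[where f = prob]) auto
    also have "\<dots> \<le> prob {\<omega>\<in>space P. gfnbp N S M ?t \<omega> = 0}"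
    proof (rule finite_measure_mono)
      have "?G ?t -` {0} \<inter> space P \<in> events"
        by (rule measurable_sets[OF G_meas]) (use s H in simp_all)
      also have "?G ?t -` {0} \<inter> space P = {\<omega>\<in>space P. gfnbp N S M ?t \<omega> = 0}" by auto
      finally show "{\<omega>\<in>space P. gfnbp N S M ?t \<omega> = 0} \<in> events" .
    qed auto
    also have "\<dots> = no_event ?t" using prob_zero[of ?t] s H by simp
    finally show ?thesis .
  qed
  ultimately show False using neg by simp
qed

end
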